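(* For all integers $n \geq 0$, \[ \overline{p}_o(3n) \equiv f(n)\,R(n,x^2+6y^2) \pmod{3} \qquad\text{and}\qquad ped(3n+1) \equiv (-1)^{n+1}R(8n+3,2x^2+3y^2) \pmod{3}. \] Moreover, for every integer $n \geq 1$ written as \[ n=2^{a} 3^{b} \prod_{i=1}^{r} p_{i}^{v_{i}} \prod_{j=1}^{s} q_{j}^{w_{j}}, \] where the $p_i$ are distinct primes with $p_{i} \equiv 1,5,7$ or $11 \pmod{24}$, the $q_j$ are distinct primes with $q_{j} \equiv 13,17,19$ or $23 \pmod{24}$, and $t$ denotes the number of prime factors of $n$, counted with multiplicity, that are congruent to $5$ or $11 \pmod{24}$, we have \[ \overline{p}_o(3n) \equiv f(n)\bigl(1 + (-1)^{a+b+t}\bigr) \prod_{i=1}^{r} (1+v_{i}) \prod_{j=1}^{s} \frac{1 + (-1)^{w_{j}}}{2} \pmod{3}, \] and for all integers $n\ge 0$, \[ (-1)^{n}\,ped(3n+1) \equiv \overline{p}_o(48n+18) \pmod{3}. \]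
   Context: For $|q|<1$ let $(a;q)_\infty=\prod_{k\ge0}(1-aq^k)$. An overpartition of $n$ is a partition of $n$ in which the first occurrence of each part may be overlined. $\overline{p}_o(n)$ is the number of overpartitions of $n$ into odd parts, with generating function $\sum_{n\ge0}\overline{p}_o(n)q^n=\frac{(-q;q^2)_\infty}{(q;q^2)_\infty}$. $ped(n)$ is the number of partitions of $n$ in which no even part is repeated, with generating function $\sum_{n\ge0}ped(n)q^n=\frac{(-q^2;q^2)_\infty}{(q;q^2)_\infty}$. For a quadratic form $Q(x,y)$, $R(n,Q)$ denotes the number of pairs $(x,y)\in\mathbb{Z}^2$ with $Q(x,y)=n$. The function $f$ is defined by $f(n)=-1$ if $n \equiv 1,6,9,10 \pmod{12}$ and $f(n)=1$ otherwise. *)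

theory Defs
  imports "HOL-Library.Multiset" "HOL-Number_Theory.Number_Theory"
begin

definition partitions_of :: "nat \<Rightarrow> nat multiset set" where
  "partitions_of n = {M. (\<forall>k\<in>#M. k > 0) \<and> sum_mset M = n}"

text \<open>
  Only the first occurrence of a part may be overlined, so an overpartition is determined by
  its underlying partition \<open>M\<close> and the set \<open>S\<close> of those part sizes whose first
  occurrence is overlined.
\<close>

definition overpartitions_of :: "nat \<Rightarrow> (nat multiset \<times> nat set) set" where
  "overpartitions_of n = {(M, S). M \<in> partitions_of n \<and> S \<subseteq> set_mset M}"

definition overp_odd :: "nat \<Rightarrow> nat" where
  "overp_odd n = card {(M, S) \<in> overpartitions_of n. \<forall>k\<in>#M. odd k}"

definition ped :: "nat \<Rightarrow> nat" where
  "ped n = card {M \<in> partitions_of n. \<forall>k\<in>#M. even k \<longrightarrow> count M k = 1}"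

text \<open>
  The cardinality of an infinite set is \<open>0\<close>, so this is meaningful only if \<open>Q\<close> represents
  \<open>n\<close> finitely often, as every positive definite form does.
\<close>

definition num_reps :: "nat \<Rightarrow> (int \<Rightarrow> int \<Rightarrow> int) \<Rightarrow> nat" where
  "num_reps n Q = card {(x, y). Q x y = int n}"

definition f_sign :: "nat \<Rightarrow> int" where
  "f_sign n = (if n mod 12 \<in> {1, 6, 9, 10} then -1 else 1)"

end

theory Submission
  imports Defs "HOL-Computational_Algebra.Formal_Power_Series" "HOL-Library.Numeral_Type"
    "HOL-Library.Discrete_Functions"
begin

text \<open>
  With \<open>\<phi>(q) = \<Sum> q\<^bsup>x^2\<^esup>\<close> and \<open>\<psi>(q) = \<Sum> q\<^bsup>k(k+1)/2\<^esup>\<close> over \<open>x \<in> \<int>\<close>, \<open>k \<ge> 0\<close>, Gauss' product formulas say that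
  the two generating functions, with \<open>q\<close> replaced by \<open>-q\<close>, are \<open>\<phi>(-q^2) / \<phi>(q)\<close> and \<open>\<psi>(q) / \<phi>(q)\<close>.
  Modulo 3 the denominator can be made a series in \<open>q^3\<close>, since \<open>\<phi>(q)^3 \<equiv> \<phi>(q^3)\<close>. The numerators become
  \<open>\<phi>(q)^2 \<phi>(-q^2)\<close> and \<open>\<phi>(q)^2 \<psi>(q)\<close>, ternary theta series whose sections along a residue class
  modulo 3 sum over the vectors on the four isotropic lines of a conic over the field with three
  elements. All four lines contribute equally, so modulo 3 one of them suffices, and its theta series
  splits into a product; the relations \<open>\<phi>(q) \<phi>(-q) = \<phi>(-q^2)^2\<close> and \<open>\<psi>(q)^2 = \<phi>(q) \<psi>(q^2)\<close> then give
  \<open>\<phi>(q) \<phi>(-q^6)\<close> and \<open>-\<phi>(q) \<psi>(q^3)\<close>.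

  The number of representations by \<open>x^2 + 6 y^2\<close> and by the other form \<open>2 x^2 + 3 y^2\<close> of discriminant
  \<open>-24\<close> is computed by adding one prime at a time: composition with a representation of a prime \<open>p\<close>,
  which exists by Thue's lemma and quadratic reciprocity, gives a Hecke recurrence.
\<close>

unbundle fps_syntax

section \<open>Weighted counting series\<close>

text \<open>The residue classes 0 and 1 modulo 3 are singled out because on them the exponent of the
  ternary theta series makes x^2 + y^2 + 2 z^2 vanish modulo 3 (with z = 2 k + 1 for the triangular
  factor). The isotropic lines meet only in zero, so one line is counted with its zero vector and
  the other three without it; those three cancel modulo 3. No infinite product is formed. Products
  are cut off after M factors and compared up to degree 2 M, where the remainder terms of the finite
  identities are invisible; quotients are avoided by cross-multiplication. Series are indexed by
  lattice points, so that theta identities become changes of variables. This is why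
  \<open>psi\<close> runs over all integers: its index set is a full lattice, its terms match pairs
  of integers one to one, and the extra factor 2 is a unit modulo 3. The two forms are the two
  classes of discriminant -24 and lie in different genera. The residue modulo 24 of a prime
  therefore decides which form represents it, and composition of classes is addition of
  parities.\<close>

definition gf :: "'i set \<Rightarrow> ('i \<Rightarrow> nat) \<Rightarrow> ('i \<Rightarrow> 'a::comm_ring_1) \<Rightarrow> 'a fps" where
  "gf S Q w = Abs_fps (\<lambda>n. \<Sum>i | i \<in> S \<and> Q i = n. w i)"

text \<open>A sum over an infinite set has the default value 0, so the coefficients of
  \<open>gf\<close> carry their meaning only under this condition, and \<open>gf_mult\<close>
  depends on it.\<close>

definition finite_fibres :: "'i set \<Rightarrow> ('i \<Rightarrow> nat) \<Rightarrow> bool" where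
  "finite_fibres S Q \<longleftrightarrow> (\<forall>n. finite {i \<in> S. Q i = n})"

lemma gf_nth: "gf S Q w $ n = (\<Sum>i | i \<in> S \<and> Q i = n. w i)"
  by (simp add: gf_def)

lemma finite_fibresD: "finite_fibres S Q \<Longrightarrow> finite {i \<in> S. Q i = n}"
  by (simp add: finite_fibres_def)

lemma gf_reindex:
  assumes "bij_betw h S' S" and "\<And>i. i \<in> S' \<Longrightarrow> Q (h i) = Q' i" and "\<And>i. i \<in> S' \<Longrightarrow> w (h i) = w' i"
  shows "gf S Q w = gf S' Q' w'"
proof (rule fps_ext)
  fix n
  have "bij_betw h {i \<in> S'. Q' i = n} {i \<in> S. Q i = n}"
    using assms(1,2) unfolding bij_betw_def inj_on_def by (auto simp: image_iff)
  then show "gf S Q w $ n = gf S' Q' w' $ n"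
    unfolding gf_nth by (subst sum.reindex_bij_betw[symmetric]) (auto intro!: sum.cong simp: assms(3))
qed

lemma finite_fibres_reindex:
  assumes "bij_betw h S' S" and "\<And>i. i \<in> S' \<Longrightarrow> Q (h i) = Q' i" and "finite_fibres S' Q'"
  shows "finite_fibres S Q"
  unfolding finite_fibres_def
proof
  fix n
  have "{i \<in> S. Q i = n} = h ` {i \<in> S'. Q' i = n}"
    using assms(1,2) unfolding bij_betw_def by auto
  then show "finite {i \<in> S. Q i = n}"
    using finite_fibresD[OF assms(3)] by simp
qed

lemma
  fixes w :: "'i \<Rightarrow> 'a::comm_ring_1"
  assumes "finite_fibres S Q" "finite_fibres T R"
  shows gf_mult: "gf S Q w * gf T R v = gf (S \<times> T) (\<lambda>(i, j). Q i + R j) (\<lambda>(i, j). w i * v j)"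
    and finite_fibres_Times: "finite_fibres (S \<times> T) (\<lambda>(i, j). Q i + R j)"
proof -
  have eq: "{ij \<in> S \<times> T. (\<lambda>(i, j). Q i + R j) ij = n} =
      (\<Union>k\<in>{0..n}. {i \<in> S. Q i = k} \<times> {j \<in> T. R j = n - k})" for n
    by auto
  show "finite_fibres (S \<times> T) (\<lambda>(i, j). Q i + R j)"
    unfolding finite_fibres_def eq using assms[THEN finite_fibresD] by auto
  show "gf S Q w * gf T R v = gf (S \<times> T) (\<lambda>(i, j). Q i + R j) (\<lambda>(i, j). w i * v j)"
  proof (rule fps_ext)
    fix n
    have "gf (S \<times> T) (\<lambda>(i, j). Q i + R j) (\<lambda>(i, j). w i * v j) $ n =
      (\<Sum>ij\<in>(\<Union>k\<in>{0..n}. {i \<in> S. Q i = k} \<times> {j \<in> T. R j = n - k}). case ij of (i, j) \<Rightarrow> w i * v j)"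
      unfolding gf_nth eq ..
    also have "\<dots> = (\<Sum>k\<in>{0..n}. \<Sum>(i, j)\<in>{i \<in> S. Q i = k} \<times> {j \<in> T. R j = n - k}. w i * v j)"
      using assms[THEN finite_fibresD] by (subst sum.UNION_disjoint) auto
    also have "\<dots> = (gf S Q w * gf T R v) $ n"
      by (simp add: fps_mult_nth gf_nth sum_product sum.cartesian_product)
    finally show "(gf S Q w * gf T R v) $ n = gf (S \<times> T) (\<lambda>(i, j). Q i + R j) (\<lambda>(i, j). w i * v j) $ n" ..
  qed
qed

section \<open>Equality of power series up to a given degree\<close>

definition agree :: "nat \<Rightarrow> 'a::comm_ring_1 fps \<Rightarrow> 'a fps \<Rightarrow> bool" where
  "agree N f g \<longleftrightarrow> (\<forall>i\<le>N. f $ i = g $ i)"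

lemma agree_refl [simp]: "agree N f f"
  and agree_sym: "agree N f g \<Longrightarrow> agree N g f"
  and agree_trans [trans]: "agree N f g \<Longrightarrow> agree N g h \<Longrightarrow> agree N f h"
  by (auto simp: agree_def)

lemma agree_add: "agree N f g \<Longrightarrow> agree N f' g' \<Longrightarrow> agree N (f + f') (g + g')"
  by (simp add: agree_def)

lemma agree_mult: "agree N f g \<Longrightarrow> agree N f' g' \<Longrightarrow> agree N (f * f') (g * g')"
  by (auto simp: agree_def fps_mult_nth intro!: sum.cong)

text \<open>The coefficient ring may have zero divisors, so both cancellation laws below multiply by
  an inverse, which a constant coefficient 1 provides.\<close>

lemma fps_unit:
  fixes f :: "'a::comm_ring_1 fps"
  assumes "f $ 0 = 1" obtains g where "g * f = 1"
  using fps_left_inverse[of 1 f] assms by auto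

lemma agree_cancel:
  assumes "f $ 0 = 1" "agree N (g * f) (h * f)" shows "agree N g h"
proof -
  obtain u where u: "u * f = 1" using fps_unit[OF assms(1)] .
  have "agree N (g * f * u) (h * f * u)"
    using assms(2) by (rule agree_mult) simp
  moreover have "f * u = 1"
    using u by (simp add: mult.commute)
  ultimately show ?thesis
    by (simp add: mult.assoc)
qed

lemma fps_cancel:
  fixes f :: "'a::comm_ring_1 fps"
  assumes "f $ 0 = 1" "g * f = h * f" shows "g = h"
proof -
  obtain u where "u * f = 1" using fps_unit[OF assms(1)] .
  then have "f * u = 1" by (simp add: mult.commute)
  moreover have "g * f * u = h * f * u" using assms(2) by simp
  ultimately show ?thesis by (simp add: mult.assoc)
qed

text \<open>\<open>F\<close> may contain indices with exponent above \<open>N\<close>, since these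
  do not touch the coefficients being compared. Hence any convenient interval of integers can serve
  as \<open>F\<close>.\<close>

lemma gf_agree_sum:
  assumes "finite F" "F \<subseteq> S" "\<And>i. i \<in> S \<Longrightarrow> Q i \<le> N \<Longrightarrow> i \<in> F"
  shows "agree N (gf S Q w) (\<Sum>i\<in>F. fps_const (w i) * fps_X ^ Q i)"
  unfolding agree_def
proof (intro allI impI)
  fix n assume "n \<le> N"
  then have eq: "{i \<in> S. Q i = n} = {i \<in> F. Q i = n}"
    using assms by auto
  have "(\<Sum>i\<in>F. fps_const (w i) * fps_X ^ Q i) $ n = (\<Sum>i\<in>F. if Q i = n then w i else 0)"
    by (auto simp: fps_sum_nth intro!: sum.cong)
  also have "\<dots> = gf S Q w $ n"
    unfolding gf_nth eq using assms(1) by (simp add: sum.inter_filter)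
  finally show "gf S Q w $ n = (\<Sum>i\<in>F. fps_const (w i) * fps_X ^ Q i) $ n" ..
qed

text \<open>A multiset with parts in \<open>{1..N}\<close> amounts to its multiplicities. The
  induction splits off the multiplicity of \<open>Suc N\<close>, which turns the index set into a
  product and the series into a product by \<open>gf_mult\<close>. Finiteness is proved alongside
  because that product rule requires it.\<close>

lemma gf_partitions:
  fixes c :: "nat \<Rightarrow> nat \<Rightarrow> 'a::comm_ring_1"
  shows "finite_fibres {M. set_mset M \<subseteq> {1..N}} (sum_mset :: nat multiset \<Rightarrow> nat)"
    and "gf {M. set_mset M \<subseteq> {1..N}} sum_mset (\<lambda>M. \<Prod>k=1..N. c k (count M k)) =
      (\<Prod>k=1..N. gf UNIV (\<lambda>m. m * k) (c k))"
proof (induction N)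
  case 0
  have *: "{M::nat multiset. set_mset M \<subseteq> {1..0}} = {{#}}"
    by auto
  { case 1 show ?case by (auto simp: * finite_fibres_def) }
  have **: "{M::nat multiset. M = {#} \<and> sum_mset M = n} = (if n = 0 then {{#}} else {})" for n
    by auto
  { case 2 show ?case by (rule fps_ext) (simp add: * ** gf_nth) }
next
  case (Suc N)
  let ?S = "\<lambda>N. {M::nat multiset. set_mset M \<subseteq> {1..N}}"
  let ?h = "\<lambda>(M, m). M + replicate_mset m (Suc N)"
  let ?Q = "\<lambda>(M, m). sum_mset M + m * Suc N"
  have bij: "bij_betw ?h (?S N \<times> UNIV) (?S (Suc N))"
  proof (rule bij_betwI[where g = "\<lambda>M. (filter_mset (\<lambda>k. k \<noteq> Suc N) M, count M (Suc N))"])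
    show "?h \<in> ?S N \<times> UNIV \<rightarrow> ?S (Suc N)"
    proof
      fix x assume "x \<in> ?S N \<times> (UNIV :: nat set)"
      then obtain M m where "x = (M, m)" "set_mset M \<subseteq> {1..N}" by auto
      then show "?h x \<in> ?S (Suc N)" by (auto simp: subset_iff le_Suc_eq)
    qed
    show "(\<lambda>M. (filter_mset (\<lambda>k. k \<noteq> Suc N) M, count M (Suc N))) \<in> ?S (Suc N) \<rightarrow> ?S N \<times> UNIV"
      by (auto simp: subset_iff)
    show "(\<lambda>M. (filter_mset (\<lambda>k. k \<noteq> Suc N) M, count M (Suc N))) (?h x) = x" if "x \<in> ?S N \<times> UNIV" for x
    proof -
      obtain M m where x: "x = (M, m)" and M: "set_mset M \<subseteq> {1..N}" using \<open>x \<in> _\<close> by auto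
      have "Suc N \<notin># M" using M by auto
      then have "count M (Suc N) = 0"
        by (simp add: count_eq_zero_iff)
      then have "filter_mset (\<lambda>k. k \<noteq> Suc N) (M + replicate_mset m (Suc N)) = M"
        by (intro multiset_eqI) auto
      then show ?thesis using \<open>count M (Suc N) = 0\<close> by (simp add: x)
    qed
    show "?h ((\<lambda>M. (filter_mset (\<lambda>k. k \<noteq> Suc N) M, count M (Suc N))) y) = y" for y
      by (rule multiset_eqI) simp
  qed
  have ff: "finite_fibres (UNIV :: nat set) (\<lambda>m. m * Suc N)"
    unfolding finite_fibres_def
  proof
    fix n show "finite {m \<in> UNIV. m * Suc N = n}"
      by (rule finite_subset[of _ "{..n}"]) auto
  qed
  have Q: "sum_mset (?h x) = ?Q x" for x
    by (auto split: prod.splits)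
  have w: "(\<Prod>k=1..Suc N. c k (count (?h x) k)) =
      (case x of (M, m) \<Rightarrow> (\<Prod>k=1..N. c k (count M k)) * c (Suc N) m)" if "x \<in> ?S N \<times> UNIV" for x
  proof -
    obtain M m where x: "x = (M, m)" and M: "set_mset M \<subseteq> {1..N}" using \<open>x \<in> _\<close> by auto
    have "Suc N \<notin># M" using M by auto
    then have [simp]: "count M (Suc N) = 0" by (auto simp: count_eq_zero_iff)
    have "(\<Prod>k=1..N. c k (count (?h x) k)) = (\<Prod>k=1..N. c k (count M k))"
      by (intro prod.cong) (auto simp: x)
    then show ?thesis by (auto simp: x)
  qed
  have reindexed: "gf (?S (Suc N)) sum_mset (\<lambda>M. \<Prod>k=1..Suc N. c k (count M k)) =
      gf (?S N \<times> UNIV) ?Q (\<lambda>(M, m). (\<Prod>k=1..N. c k (count M k)) * c (Suc N) m)"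
  proof (rule gf_reindex[OF bij])
    fix x assume "x \<in> ?S N \<times> (UNIV :: nat set)"
    then show "(\<Prod>k=1..Suc N. c k (count (?h x) k)) =
        (case x of (M, m) \<Rightarrow> (\<Prod>k=1..N. c k (count M k)) * c (Suc N) m)"
      by (rule w)
  qed (rule Q)
  { case 1
    show ?case
      by (rule finite_fibres_reindex[OF bij Q finite_fibres_Times[OF Suc.IH(1) ff]]) }
  { case 2
    show ?case
      unfolding reindexed gf_mult[OF Suc.IH(1) ff, symmetric] Suc.IH(2)
      by simp }
qed

section \<open>Gauss' identities in finite form\<close>

text \<open>
  Shanks' finite forms of Gauss' identities: the terms with \<open>s > 0\<close> on the right are divisible by a
  power of \<open>q\<close> that tends to infinity with \<open>n\<close>.
\<close>

lemma finite_Gauss_square_identity: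
  fixes q :: "'a::comm_ring_1"
  shows "(\<Prod>k=1..n. 1 + q ^ k) * (\<Sum>k=-int n..int n. (-1) ^ nat \<bar>k\<bar> * q ^ nat (k\<^sup>2)) =
    (\<Prod>k=1..n. 1 - q ^ k) +
    2 * (\<Sum>s=1..n. (-1) ^ s * (\<Prod>k=s+1..n. 1 - q ^ k) * (\<Prod>k=1..<s. 1 + q ^ k) * q ^ (s * (n + 1)))"
proof (induction n)
  case 0 show ?case by simp
next
  case (Suc n)
  define N where "N s = (\<Prod>k=s+1..n. 1 - q ^ k)" for s
  define L where "L s = (\<Prod>k=1..s. 1 + q ^ k)" for s
  define Q where "Q = q ^ (n + 1)"
  define t where "t n s = (-1) ^ s * (\<Prod>k=s+1..n. 1 - q ^ k) * (\<Prod>k=1..<s. 1 + q ^ k) * q ^ (s * (n + 1))" for n s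
  \<comment> \<open>\<open>W\<close> is a telescoping certificate: by \<open>step\<close>,
    \<open>t (Suc n) s\<close> and \<open>(1 + Q) * t n s\<close> differ by consecutive values of
    \<open>W\<close>, so only boundary values enter the sum.\<close>
  define W where "W s = (-1) ^ s * N s * L s * q ^ ((s + 1) * (n + 1))" for s
  define S where "S n = (\<Sum>k=-int n..int n. (-1) ^ nat \<bar>k\<bar> * q ^ nat (k\<^sup>2))" for n :: nat
  have step: "t (Suc n) s = (1 + Q) * t n s + (W (s - 1) - W s)" if "s \<in> {1..n}" for s
  proof -
    define r where "r = s - 1"
    then have s: "s = Suc r" and r: "r < n" using that by auto
    define B where "B = (-1) ^ r * N s * L r * q ^ (s * (n + 1))"
    have "{s + 1..Suc n} = insert (Suc n) {s + 1..n}" using r s by auto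
    then have "t (Suc n) s = - B * (1 - Q) * q ^ s"
      by (simp add: t_def B_def N_def L_def Q_def s atLeastLessThanSuc_atLeastAtMost power_add algebra_simps)
    moreover have "t n s = - B"
      by (simp add: t_def B_def N_def L_def s atLeastLessThanSuc_atLeastAtMost)
    moreover have "W s = - B * (1 + q ^ s) * Q"
      by (simp add: W_def B_def L_def Q_def s power_add algebra_simps)
    moreover have "N r = (1 - q ^ s) * N s"
      using r by (simp add: N_def s prod.atLeast_Suc_atMost)
    then have "W (s - 1) = B * (1 - q ^ s)"
      unfolding W_def B_def by (simp only: s diff_Suc_1) simp
    ultimately show ?thesis
      by (simp only:) (simp add: algebra_simps)
  qed
  have "(\<Sum>s=1..n. t (Suc n) s) = (1 + Q) * (\<Sum>s=1..n. t n s) + (\<Sum>s=1..n. W (s - 1) - W s)"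
    by (simp add: step sum.distrib sum_distrib_left)
  also have "(\<Sum>s=1..n. W (s - 1) - W s) = W 0 - W n"
    by (induction n) auto
  finally have F: "(\<Sum>s=1..n. t (Suc n) s) = (1 + Q) * (\<Sum>s=1..n. t n s) + (W 0 - W n)" .
  have S: "S (Suc n) = S n - 2 * (-1) ^ n * q ^ ((n + 1) * (n + 1))"
  proof -
    have "{- int (Suc n)..int (Suc n)} = insert (int (Suc n)) (insert (- int (Suc n)) {- int n..int n})"
      by auto
    moreover have "nat ((1 + int n)\<^sup>2) = (n + 1) * (n + 1)" "nat ((- 1 - int n)\<^sup>2) = (n + 1) * (n + 1)"
      by (auto simp: power2_eq_square nat_eq_iff algebra_simps)
    moreover have "nat \<bar>- 1 - int n\<bar> = Suc n" "nat \<bar>1 + int n\<bar> = Suc n"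
      by auto
    ultimately show ?thesis
      unfolding S_def by (simp add: algebra_simps)
  qed
  have W0: "W 0 = N 0 * Q" and Wn: "W n = (-1) ^ n * L n * q ^ ((n + 1) * (n + 1))"
    by (simp_all add: W_def L_def Q_def N_def)
  have tn: "t (Suc n) (Suc n) = - ((-1) ^ n) * L n * q ^ ((n + 1) * (n + 1)) * Q"
    by (simp add: t_def L_def Q_def atLeastLessThanSuc_atLeastAtMost power_add algebra_simps)
  have L: "L (Suc n) = L n * (1 + Q)" and N: "(\<Prod>k=1..Suc n. 1 - q ^ k) = N 0 * (1 - Q)"
    by (simp_all add: L_def N_def Q_def)
  have IH: "L n * S n = N 0 + 2 * (\<Sum>s=1..n. t n s)"
    using Suc.IH by (simp add: L_def S_def N_def t_def)
  have "L (Suc n) * S (Suc n) = (1 + Q) * (L n * S n) - 2 * (1 + Q) * L n * (-1) ^ n * q ^ ((n + 1) * (n + 1))"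
    unfolding L S by (simp add: algebra_simps)
  \<comment> \<open>The boundary value \<open>W 0\<close> turns \<open>(1 + Q) * N 0\<close> into
    \<open>(1 - Q) * N 0\<close>, and \<open>W n\<close> combines with the two new squares into the
    new summand for \<open>Suc n\<close>.\<close>
  also have "\<dots> = N 0 * (1 - Q) + 2 * ((\<Sum>s=1..n. t (Suc n) s) + t (Suc n) (Suc n))"
    unfolding IH F W0 Wn tn by (simp add: algebra_simps)
  also have "\<dots> = (\<Prod>k=1..Suc n. 1 - q ^ k) + 2 * (\<Sum>s=1..Suc n. t (Suc n) s)"
    unfolding N by simp
  finally show ?case
    unfolding L_def S_def t_def by simp
qed

lemma finite_Gauss_triangular_identity:
  fixes q :: "'a::comm_ring_1"
  shows "(\<Prod>k<n. 1 - q ^ (2 * k + 1)) * (\<Sum>k<2 * n. q ^ (k * (k + 1) div 2)) =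
    (\<Sum>s<n. (\<Prod>k=s+1..n. 1 - q ^ (2 * k)) * (\<Prod>k<s. 1 - q ^ (2 * k + 1)) * q ^ (s * (2 * n + 1)))"
proof (induction n)
  case 0 show ?case by simp
next
  case (Suc n)
  define B where "B s = (\<Prod>k=s+1..n. 1 - q ^ (2 * k))" for s
  define A where "A s = (\<Prod>k<s. 1 - q ^ (2 * k + 1))" for s
  define Q where "Q = q ^ (2 * n + 1)"
  define u where "u n s = (\<Prod>k=s+1..n. 1 - q ^ (2 * k)) * (\<Prod>k<s. 1 - q ^ (2 * k + 1)) * q ^ (s * (2 * n + 1))" for n s
  \<comment> \<open>Again a telescoping certificate; its first factor vanishes at s = 0, so that
    only \<open>V n\<close> remains as a boundary term.\<close>
  define V where "V s = (1 - q ^ (2 * s)) * B s * A s * Q ^ s" for s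
  have step: "u (Suc n) s = (1 - Q) * u n s + (V (Suc s) - V s)" if "s \<in> {..<n}" for s
  proof -
    from that have s: "s < n" by simp
    define C where "C = B s * A s * Q ^ s"
    have "{s + 1..Suc n} = insert (Suc n) {s + 1..n}" using s by auto
    moreover have "q ^ (s * (2 * Suc n + 1)) = Q ^ s * q ^ (2 * s)"
      unfolding Q_def power_mult[symmetric] power_add[symmetric] by (simp add: algebra_simps)
    moreover have "q ^ (2 * Suc n) = q * Q"
      by (simp add: Q_def)
    ultimately have "u (Suc n) s = C * (1 - q * Q) * (q ^ (2 * s))"
      unfolding u_def C_def A_def B_def using s by simp
    moreover have "q ^ (s * (2 * n + 1)) = Q ^ s"
      unfolding Q_def power_mult[symmetric] by (simp only: mult.commute)
    then have "u n s = C"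
      by (simp add: u_def C_def A_def B_def)
    moreover have "V s = C * (1 - q ^ (2 * s))"
      by (simp add: V_def C_def algebra_simps)
    moreover have "(1 - q ^ (2 * Suc s)) * B (Suc s) = B s"
      using s by (simp add: B_def prod.atLeast_Suc_atMost)
    then have "V (Suc s) = B s * A (Suc s) * Q ^ Suc s"
      unfolding V_def by simp
    then have "V (Suc s) = C * Q * (1 - q * q ^ (2 * s))"
      by (simp add: A_def C_def algebra_simps)
    ultimately show ?thesis
      by (simp only:) (simp add: algebra_simps)
  qed
  have "(\<Sum>s<n. u (Suc n) s) = (1 - Q) * (\<Sum>s<n. u n s) + (\<Sum>s<n. V (Suc s) - V s)"
    by (simp add: step sum.distrib sum_distrib_left)
  also have "(\<Sum>s<n. V (Suc s) - V s) = V n - V 0"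
    by (rule sum_lessThan_telescope)
  finally have F: "(\<Sum>s<n. u (Suc n) s) = (1 - Q) * (\<Sum>s<n. u n s) + (V n - V 0)" .
  have V: "V 0 = 0" "V n = (1 - q ^ (2 * n)) * A n * Q ^ n"
    by (simp_all add: V_def B_def)
  \<comment> \<open>The summand at n has no counterpart in the sum for n. Together with
    \<open>V n\<close> it gives \<open>A n * Q ^ n * (1 - Q * Q)\<close>.\<close>
  have un: "u (Suc n) n = (q ^ (2 * n) - Q * Q) * A n * Q ^ n"
  proof -
    have "q ^ (n * (2 * Suc n + 1)) = q ^ (2 * n) * Q ^ n"
      unfolding Q_def power_mult[symmetric] power_add[symmetric] by (simp add: algebra_simps)
    moreover have "q ^ (2 * n) * q ^ (2 * Suc n) = Q * Q"
      unfolding Q_def power_mult[symmetric] power_add[symmetric] by (simp add: algebra_simps)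
    ultimately have "q ^ (n * (2 * Suc n + 1)) * (1 - q ^ (2 * Suc n)) = (q ^ (2 * n) - Q * Q) * Q ^ n"
      by (simp only: right_diff_distrib left_diff_distrib) (simp add: mult_ac)
    moreover have "u (Suc n) n = q ^ (n * (2 * Suc n + 1)) * (1 - q ^ (2 * Suc n)) * A n"
      by (simp add: u_def A_def mult_ac)
    ultimately show ?thesis
      by (simp only: mult_ac)
  qed
  \<comment> \<open>The new indices 2 n and 2 n + 1 have triangular numbers n (2 n + 1) and (n + 1)
    (2 n + 1), hence the powers \<open>Q ^ n\<close> and \<open>Q ^ (n + 1)\<close>.\<close>
  have T: "(\<Sum>k<2 * Suc n. q ^ (k * (k + 1) div 2)) = (\<Sum>k<2 * n. q ^ (k * (k + 1) div 2)) + Q ^ n * (1 + Q)"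
  proof -
    have "2 * n * (2 * n + 1) div 2 = (2 * n + 1) * n" "(2 * n + 1) * (2 * n + 1 + 1) div 2 = (2 * n + 1) * (n + 1)"
      by auto
    then show ?thesis
      by (simp add: Q_def algebra_simps flip: power_mult power_add)
  qed
  have A: "A (Suc n) = A n * (1 - Q)"
    by (simp add: A_def Q_def)
  have "A (Suc n) * (\<Sum>k<2 * Suc n. q ^ (k * (k + 1) div 2)) =
      (1 - Q) * (A n * (\<Sum>k<2 * n. q ^ (k * (k + 1) div 2))) + A n * Q ^ n * (1 - Q * Q)"
    unfolding A T by (simp add: algebra_simps)
  also have "A n * (\<Sum>k<2 * n. q ^ (k * (k + 1) div 2)) = (\<Sum>s<n. u n s)"
    using Suc.IH by (simp add: A_def u_def)
  also have "(1 - Q) * (\<Sum>s<n. u n s) + A n * Q ^ n * (1 - Q * Q) = (\<Sum>s<Suc n. u (Suc n) s)"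
    unfolding sum.lessThan_Suc F un V by (simp add: algebra_simps)
  finally show ?case
    unfolding A_def u_def .
qed

section \<open>Generating functions of the partition counts\<close>

text \<open>A common frame for both partition counts: \<open>e k m\<close> is the number of
  admissible ways to have the part \<open>k\<close> exactly \<open>m\<close> times, with 0 for a
  forbidden multiplicity.\<close>

definition ptn_weight :: "(nat \<Rightarrow> nat \<Rightarrow> nat) \<Rightarrow> nat \<Rightarrow> nat" where
  "ptn_weight e n = (\<Sum>M\<in>partitions_of n. \<Prod>k\<in>set_mset M. e k (count M k))"

text \<open>The Euler factor of the part \<open>k\<close>; the sign performs the substitution of -q
  for q.\<close>

definition part_factor :: "(nat \<Rightarrow> nat \<Rightarrow> nat) \<Rightarrow> nat \<Rightarrow> 'a::comm_ring_1 fps" where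
  "part_factor e k = gf UNIV (\<lambda>m. m * k) (\<lambda>m. (-1) ^ (m * k) * of_nat (e k m))"

lemma in_partitions_of_le: "M \<in> partitions_of n \<Longrightarrow> k \<in># M \<Longrightarrow> k \<le> n"
  by (auto simp: partitions_of_def dest!: multi_member_split)

lemma partitions_of_eq:
  assumes "n \<le> N"
  shows "{M. set_mset M \<subseteq> {1..N} \<and> sum_mset M = n} = partitions_of n"
proof -
  have "set_mset M \<subseteq> {1..N}" if "M \<in> partitions_of n" for M
    using that in_partitions_of_le[OF that] assms by (fastforce simp: partitions_of_def)
  then show ?thesis
    by (auto simp: partitions_of_def)
qed

text \<open>Partitions of n use parts of size at most n only, and absent parts contribute the factor
  1. The signs of the factors multiply to \<open>(-1) ^ n\<close> because the products of part and
  multiplicity add up to n.\<close>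

lemma agree_ptn_weight:
  assumes e: "\<And>k. e k 0 = 1"
  shows "agree N (Abs_fps (\<lambda>n. (-1) ^ n * of_nat (ptn_weight e n)) :: 'a::comm_ring_1 fps)
    (\<Prod>k=1..N. part_factor e k)"
  unfolding agree_def
proof (intro allI impI)
  fix n assume "n \<le> N"
  have "(\<Prod>k=1..N. (-1) ^ (count M k * k) * of_nat (e k (count M k)) :: 'a) =
      (-1) ^ n * of_nat (\<Prod>k\<in>set_mset M. e k (count M k))" if M: "set_mset M \<subseteq> {1..N}" "sum_mset M = n" for M
  proof -
    have "(\<Prod>k=1..N. (-1) ^ (count M k * k) * of_nat (e k (count M k)) :: 'a) =
        (\<Prod>k\<in>set_mset M. (-1) ^ (count M k * k) * of_nat (e k (count M k)))"
      using M by (intro prod.mono_neutral_right) (auto simp: e not_in_iff)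
    also have "\<dots> = (\<Prod>k\<in>set_mset M. ((-1) ^ k) ^ count M k) * of_nat (\<Prod>k\<in>set_mset M. e k (count M k))"
      by (simp add: prod.distrib mult.commute flip: power_mult)
    also have "(\<Prod>k\<in>set_mset M. ((-1) ^ k) ^ count M k) = (-1 :: 'a) ^ sum_mset M"
      unfolding image_prod_mset_multiplicity[symmetric] by (induction M) (simp_all add: power_add)
    also have "sum_mset M = n" by (rule M)
    finally show ?thesis .
  qed
  then show "Abs_fps (\<lambda>n. (-1) ^ n * of_nat (ptn_weight e n)) $ n = (\<Prod>k=1..N. part_factor e k :: 'a fps) $ n"
    using partitions_of_eq[OF \<open>n \<le> N\<close>] unfolding part_factor_def gf_partitions(2)[symmetric] gf_nth mem_Collect_eq
    by (simp add: ptn_weight_def sum_distrib_left flip: partitions_of_eq[OF \<open>n \<le> N\<close>])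
qed

lemma finite_partitions_of: "finite (partitions_of n)"
  using finite_fibresD[OF gf_partitions(1)[of n], of n] partitions_of_eq[of n n] by simp

text \<open>The value 2 is the choice of overlining the first copy or not, whatever the positive
  multiplicity.\<close>

definition overp_odd_weight :: "nat \<Rightarrow> nat \<Rightarrow> nat" where
  "overp_odd_weight k m = (if m = 0 then 1 else if odd k then 2 else 0)"

definition ped_weight :: "nat \<Rightarrow> nat \<Rightarrow> nat" where
  "ped_weight k m = (if odd k \<or> m \<le> 1 then 1 else 0)"

lemma overp_odd_weight_0: "overp_odd_weight k 0 = 1"
  and ped_weight_0: "ped_weight k 0 = 1"
  by (simp_all add: overp_odd_weight_def ped_weight_def)

lemma overp_odd_eq_ptn_weight: "overp_odd n = ptn_weight overp_odd_weight n"
proof -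
  have "overp_odd n = card (SIGMA M:{M \<in> partitions_of n. \<forall>k\<in>#M. odd k}. Pow (set_mset M))"
    unfolding overp_odd_def overpartitions_of_def by (rule arg_cong[where f = card]) auto
  also have "\<dots> = (\<Sum>M | M \<in> partitions_of n \<and> (\<forall>k\<in>#M. odd k). 2 ^ card (set_mset M))"
    using finite_partitions_of[of n] by (simp add: card_SigmaI card_Pow)
  also have "\<dots> = (\<Sum>M\<in>partitions_of n. if \<forall>k\<in>#M. odd k then 2 ^ card (set_mset M) else 0)"
    using finite_partitions_of[of n] by (simp add: sum.inter_filter)
  also have "\<dots> = ptn_weight overp_odd_weight n"
    unfolding ptn_weight_def
  proof (rule sum.cong[OF refl])
    fix M :: "nat multiset"
    have "(\<Prod>k\<in>set_mset M. overp_odd_weight k (count M k)) = (\<Prod>k\<in>set_mset M. if odd k then 2 else 0)"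
      by (intro prod.cong) (auto simp: overp_odd_weight_def count_eq_zero_iff)
    then show "(if \<forall>k\<in>#M. odd k then 2 ^ card (set_mset M) else 0) =
        (\<Prod>k\<in>set_mset M. overp_odd_weight k (count M k))"
      by (auto intro!: prod_zero)
  qed
  finally show ?thesis .
qed

lemma ped_eq_ptn_weight: "ped n = ptn_weight ped_weight n"
proof -
  have "ped n = (\<Sum>M\<in>partitions_of n. if \<forall>k\<in>#M. even k \<longrightarrow> count M k = 1 then 1 else 0)"
    using finite_partitions_of[of n] unfolding ped_def by (simp add: sum.inter_filter flip: sum.inter_filter)
  also have "\<dots> = ptn_weight ped_weight n"
    unfolding ptn_weight_def
  proof (rule sum.cong[OF refl])
    fix M :: "nat multiset"
    show "(if \<forall>k\<in>#M. even k \<longrightarrow> count M k = 1 then 1 else 0) =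
        (\<Prod>k\<in>set_mset M. ped_weight k (count M k))"
    proof (cases "\<forall>k\<in>#M. even k \<longrightarrow> count M k = 1")
      case True then show ?thesis by (auto simp: ped_weight_def intro!: prod.neutral[symmetric])
    next
      case False
      then obtain k where "k \<in># M" "even k" "count M k \<noteq> 1" by blast
      moreover from this have "count M k > 1" by (metis count_greater_eq_one_iff le_neq_implies_less)
      ultimately show ?thesis using False
        by (auto simp: ped_weight_def intro!: prod_zero[symmetric] bexI[of _ k])
    qed
  qed
  finally show ?thesis .
qed

lemma part_factor_nth:
  assumes "k > 0"
  shows "part_factor e k $ n = (if k dvd n then (-1) ^ n * of_nat (e k (n div k)) else 0)"
proof -
  have "{m. m * k = n} = (if k dvd n then {n div k} else {})"
    using assms by auto
  then show ?thesis
    unfolding part_factor_def gf_nth using assms by auto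
qed

lemma fps_mult_one_plus_X_power_nth:
  "(f * (1 + fps_X ^ k)) $ n = f $ n + (if n < k then 0 else f $ (n - k))"
  for f :: "'a::comm_ring_1 fps"
  by (simp add: distrib_left fps_X_power_mult_right_nth)

lemma fps_eq_multiplesI:
  fixes f g :: "'a::comm_ring_1 fps"
  assumes "\<And>n. \<not> k dvd n \<Longrightarrow> f $ n = g $ n" "\<And>m. f $ (m * k) = g $ (m * k)"
  shows "f = g"
  using assms by (intro fps_ext) (metis dvd_def mult.commute)

text \<open>For odd k the factor is 1 + 2 (y + y^2 + ...) = (1 + y) / (1 - y) with y = -q^k.\<close>

lemma overp_factor_odd:
  assumes "odd k"
  shows "part_factor overp_odd_weight k * (1 + fps_X ^ k) = (1 - fps_X ^ k :: 'a::comm_ring_1 fps)"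
proof (rule fps_eq_multiplesI[where k = k])
  have k: "k > 0" using assms by (auto elim: oddE)
  show "(part_factor overp_odd_weight k * (1 + fps_X ^ k)) $ n = (1 - fps_X ^ k :: 'a fps) $ n" if "\<not> k dvd n" for n
    using that k dvd_diffD[of k n k] by (cases "n = 0") (auto simp: fps_mult_one_plus_X_power_nth part_factor_nth not_less)
  show "(part_factor overp_odd_weight k * (1 + fps_X ^ k)) $ (m * k) = (1 - fps_X ^ k :: 'a fps) $ (m * k)" for m
  proof (cases m)
    case 0 then show ?thesis using k by (simp add: fps_mult_one_plus_X_power_nth part_factor_nth overp_odd_weight_def)
  next
    case (Suc l)
    then show ?thesis using k assms
      by (cases l) (auto simp: fps_mult_one_plus_X_power_nth part_factor_nth overp_odd_weight_def power_add)
  qed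
qed

lemma ped_factor_odd:
  assumes "odd k"
  shows "part_factor ped_weight k * (1 + fps_X ^ k) = (1 :: 'a::comm_ring_1 fps)"
proof (rule fps_eq_multiplesI[where k = k])
  have k: "k > 0" using assms by (auto elim: oddE)
  show "(part_factor ped_weight k * (1 + fps_X ^ k)) $ n = (1 :: 'a fps) $ n" if "\<not> k dvd n" for n
    using that k dvd_diffD[of k n k] by (cases "n = 0") (auto simp: fps_mult_one_plus_X_power_nth part_factor_nth not_less)
  show "(part_factor ped_weight k * (1 + fps_X ^ k)) $ (m * k) = (1 :: 'a fps) $ (m * k)" for m
    using k assms by (cases m) (auto simp: fps_mult_one_plus_X_power_nth part_factor_nth ped_weight_def power_add)
qed

lemma overp_factor_even:
  assumes "even k" "k > 0"
  shows "part_factor overp_odd_weight k = (1 :: 'a::comm_ring_1 fps)"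
  using assms by (intro fps_ext) (auto simp: part_factor_nth overp_odd_weight_def elim!: dvdE)

lemma ped_factor_even:
  assumes "even k" "k > 0"
  shows "part_factor ped_weight k = (1 + fps_X ^ k :: 'a::comm_ring_1 fps)"
proof (rule fps_eq_multiplesI[where k = k])
  show "part_factor ped_weight k $ n = (1 + fps_X ^ k :: 'a fps) $ n" if "\<not> k dvd n" for n
    using that assms by (cases "n = 0") (auto simp: part_factor_nth)
  show "part_factor ped_weight k $ (m * k) = (1 + fps_X ^ k :: 'a fps) $ (m * k)" for m
    using assms by (auto simp: part_factor_nth ped_weight_def)
qed

lemma prod_pair: "(\<Prod>k=1..2*M. f k) = (\<Prod>j<M. f (2 * j + 1)) * (\<Prod>j=1..M. f (2 * j))"
  for f :: "nat \<Rightarrow> 'a::comm_monoid_mult"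
  by (induction M) (simp_all add: mult_ac)

lemma agree_overp:
  "agree (2 * M) (Abs_fps (\<lambda>n. (-1) ^ n * of_nat (overp_odd n)) * (\<Prod>j<M. 1 + fps_X ^ (2 * j + 1)))
    (\<Prod>j<M. 1 - fps_X ^ (2 * j + 1) :: 'a::comm_ring_1 fps)"
proof -
  have "(\<Prod>k=1..2*M. part_factor overp_odd_weight k :: 'a fps) =
      (\<Prod>j<M. part_factor overp_odd_weight (2 * j + 1))"
    unfolding prod_pair by (simp add: overp_factor_even)
  then have "(\<Prod>k=1..2*M. part_factor overp_odd_weight k) * (\<Prod>j<M. 1 + fps_X ^ (2 * j + 1)) =
      (\<Prod>j<M. part_factor overp_odd_weight (2 * j + 1) * (1 + fps_X ^ (2 * j + 1)) :: 'a fps)"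
    by (simp only: prod.distrib)
  also have "\<dots> = (\<Prod>j<M. 1 - fps_X ^ (2 * j + 1))"
    by (intro prod.cong refl overp_factor_odd) simp
  finally have "(\<Prod>k=1..2*M. part_factor overp_odd_weight k) * (\<Prod>j<M. 1 + fps_X ^ (2 * j + 1)) =
      (\<Prod>j<M. 1 - fps_X ^ (2 * j + 1) :: 'a fps)" .
  then show ?thesis
    unfolding overp_odd_eq_ptn_weight
    by (rule subst) (rule agree_mult[OF agree_ptn_weight agree_refl], rule overp_odd_weight_0)
qed

lemma agree_ped:
  "agree (2 * M) (Abs_fps (\<lambda>n. (-1) ^ n * of_nat (ped n)) * (\<Prod>j<M. 1 + fps_X ^ (2 * j + 1)))
    (\<Prod>j=1..M. 1 + fps_X ^ (2 * j) :: 'a::comm_ring_1 fps)"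
proof -
  have even: "(\<Prod>j=1..M. part_factor ped_weight (2 * j)) = (\<Prod>j=1..M. 1 + fps_X ^ (2 * j) :: 'a fps)"
    by (intro prod.cong refl ped_factor_even) simp_all
  have odd: "(\<Prod>j<M. part_factor ped_weight (2 * j + 1) * (1 + fps_X ^ (2 * j + 1)) :: 'a fps) = 1"
    by (intro prod.neutral ballI ped_factor_odd) simp
  have "(\<Prod>k=1..2*M. part_factor ped_weight k) * (\<Prod>j<M. 1 + fps_X ^ (2 * j + 1)) =
      (\<Prod>j<M. part_factor ped_weight (2 * j + 1) * (1 + fps_X ^ (2 * j + 1)) :: 'a fps) *
      (\<Prod>j=1..M. part_factor ped_weight (2 * j))"
    unfolding prod_pair prod.distrib by (simp only: mult_ac)
  also have "\<dots> = (\<Prod>j=1..M. 1 + fps_X ^ (2 * j))"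
    unfolding even odd by simp
  finally have "(\<Prod>k=1..2*M. part_factor ped_weight k) * (\<Prod>j<M. 1 + fps_X ^ (2 * j + 1)) =
      (\<Prod>j=1..M. 1 + fps_X ^ (2 * j) :: 'a fps)" .
  then show ?thesis
    unfolding ped_eq_ptn_weight
    by (rule subst) (rule agree_mult[OF agree_ptn_weight agree_refl], rule ped_weight_0)
qed

section \<open>Theta series\<close>

definition sg :: "int \<Rightarrow> 'a::comm_ring_1" where
  "sg x = (if even x then 1 else -1)"

definition phi :: "nat \<Rightarrow> 'a::comm_ring_1 fps" where
  "phi m = gf UNIV (\<lambda>x::int. m * nat (x\<^sup>2)) (\<lambda>_. 1)"

definition phi_alt :: "nat \<Rightarrow> 'a::comm_ring_1 fps" where
  "phi_alt m = gf UNIV (\<lambda>x::int. m * nat (x\<^sup>2)) sg"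

definition tri :: "int \<Rightarrow> nat" where
  "tri k = nat (k * (k + 1) div 2)"

text \<open>Summing over all integers gives twice Ramanujan's \<open>\<psi>\<close>.\<close>

definition psi :: "nat \<Rightarrow> 'a::comm_ring_1 fps" where
  "psi m = gf UNIV (\<lambda>k::int. m * tri k) (\<lambda>_. 1)"

lemma tri_nonneg: "0 \<le> k * (k + 1)" for k :: int
  by (cases "0 \<le> k") (auto simp: mult_nonpos_nonpos)

lemma two_int_tri: "2 * int (tri k) = k * (k + 1)"
  using tri_nonneg[of k] by (simp add: tri_def)

lemma tri_reflect: "tri (- 1 - k) = tri k"
  unfolding tri_def by (simp add: algebra_simps)

lemma tri_bound: "\<bar>k\<bar> \<le> int (tri k) + 1"
proof (cases "0 \<le> k")
  case True
  have "2 * k \<le> k * (k + 1)"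
  proof (cases "k = 0")
    case False with True show ?thesis using mult_left_mono[of 2 "k + 1" k] by (simp add: mult.commute)
  qed simp
  then show ?thesis using True two_int_tri[of k] by simp
next
  case False
  have "2 * (- k - 1) \<le> (- k - 1) * (- k)"
  proof (cases "k = -1")
    case False with \<open>\<not> 0 \<le> k\<close> have "2 \<le> - k" "0 \<le> - k - 1" by auto
    then show ?thesis using mult_left_mono[of 2 "- k" "- k - 1"] by (simp add: algebra_simps)
  qed simp
  also have "(- k - 1) * (- k) = k * (k + 1)" by (simp add: algebra_simps)
  finally have "2 * (- k - 1) \<le> 2 * int (tri k)" using two_int_tri[of k] by simp
  then have "- k - 1 \<le> int (tri k)" by (simp only: mult_le_cancel_left_pos zero_less_numeral)
  moreover have "\<bar>k\<bar> = - k" using \<open>\<not> 0 \<le> k\<close> by simp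
  ultimately show ?thesis by simp
qed

lemma abs_le_square: "\<bar>x\<bar> \<le> x\<^sup>2" for x :: int
proof (cases "x = 0")
  case False
  then have "\<bar>x\<bar> * 1 \<le> \<bar>x\<bar> * \<bar>x\<bar>" by (intro mult_left_mono) auto
  then show ?thesis by (simp add: power2_eq_square)
qed simp

lemma sq_bound: "\<bar>x\<bar> \<le> int (nat (x\<^sup>2))" for x :: int
  using abs_le_square[of x] by simp

lemma sg_eq_power: "(-1) ^ nat \<bar>x\<bar> = sg x"
  by (simp add: sg_def even_nat_iff uminus_power_if)

lemma sg_diff: "sg (x - y) = sg x * sg y"
  and sg_minus: "sg (- x) = sg x"
  by (auto simp: sg_def)

lemma finite_fibres_square:
  assumes "m > 0" shows "finite_fibres (UNIV :: int set) (\<lambda>x. m * nat (x\<^sup>2))"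
  unfolding finite_fibres_def
proof
  fix n
  have "x \<in> {-int n..int n}" if "m * nat (x\<^sup>2) = n" for x
  proof -
    have "nat (x\<^sup>2) \<le> n" using that assms by (cases m) auto
    then show ?thesis using sq_bound[of x] by (auto simp: abs_le_iff)
  qed
  then have "{x \<in> UNIV. m * nat (x\<^sup>2) = n} \<subseteq> {-int n..int n}" by blast
  then show "finite {x \<in> UNIV. m * nat (x\<^sup>2) = n}" by (rule finite_subset) simp
qed

lemma finite_fibres_tri:
  assumes "m > 0" shows "finite_fibres UNIV (\<lambda>k. m * tri k)"
  unfolding finite_fibres_def
proof
  fix n
  have "k \<in> {-int n - 1..int n + 1}" if "m * tri k = n" for k
  proof -
    have "tri k \<le> n" using that assms by (cases m) auto
    then show ?thesis using tri_bound[of k] by (auto simp: abs_le_iff)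
  qed
  then have "{x \<in> UNIV. m * tri x = n} \<subseteq> {-int n - 1..int n + 1}" by blast
  then show "finite {x \<in> UNIV. m * tri x = n}" by (rule finite_subset) simp
qed

lemma phi_nth_0: "phi 1 $ 0 = (1 :: 'a::comm_ring_1)"
  by (simp add: phi_def gf_nth)

lemma prod_nth_0: "(\<Prod>i\<in>A. f i) $ 0 = (\<Prod>i\<in>A. f i $ 0 :: 'a::comm_ring_1)"
  by (induction A rule: infinite_finite_induct) auto

lemma agree_sum: "(\<And>i. i \<in> A \<Longrightarrow> agree N (f i) (g i)) \<Longrightarrow> agree N (\<Sum>i\<in>A. f i) (\<Sum>i\<in>A. g i)"
  by (auto simp: agree_def fps_sum_nth)

lemma agree_0_X_power: "N < k \<Longrightarrow> agree N (f * fps_X ^ k) 0"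
  by (auto simp: agree_def fps_X_power_mult_right_nth)

lemma agree_mult_right: "agree N f 0 \<Longrightarrow> agree N (g * f) 0"
  using agree_mult[OF agree_refl, of N f 0 g] by simp

lemma fps_const_sg: "fps_const (sg x) = sg x"
  by (simp add: sg_def flip: fps_const_neg)

text \<open>The square identity is used at q = -X. As k and k^2 have the same parity, this
  substitution absorbs the alternating signs of the sum, while on the product side it exchanges 1 +
  X^k and 1 - X^k for odd k only.\<close>

lemma agree_phi:
  "agree (2 * M) (phi 1 * ((\<Prod>j<M. 1 - fps_X ^ (2 * j + 1)) * (\<Prod>j=1..M. 1 + fps_X ^ (2 * j))))
    ((\<Prod>j<M. 1 + fps_X ^ (2 * j + 1)) * (\<Prod>j=1..M. 1 - fps_X ^ (2 * j)) :: 'a::comm_ring_1 fps)"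
proof -
  define q :: "'a fps" where "q = - fps_X"
  have q: "q ^ k = (-1) ^ k * fps_X ^ k" for k
    unfolding q_def by (rule power_minus)
  let ?F = "{-int (2 * M)..int (2 * M)}"
  have "agree (2 * M) (phi 1 :: 'a fps) (\<Sum>x\<in>?F. fps_const 1 * fps_X ^ (1 * nat (x\<^sup>2)))"
    unfolding phi_def
  proof (rule gf_agree_sum)
    fix x :: int assume "1 * nat (x\<^sup>2) \<le> 2 * M"
    then show "x \<in> ?F" using sq_bound[of x] by (auto simp: abs_le_iff)
  qed auto
  also have "(\<Sum>x\<in>?F. fps_const 1 * fps_X ^ (1 * nat (x\<^sup>2))) = (\<Sum>x\<in>?F. (-1) ^ nat \<bar>x\<bar> * q ^ nat (x\<^sup>2))"
  proof (rule sum.cong)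
    fix x :: int
    have "(-1) ^ nat \<bar>x\<bar> * (-1) ^ nat (x\<^sup>2) = (1 :: 'a fps)"
      by (auto simp: uminus_power_if even_nat_iff)
    then show "fps_const 1 * fps_X ^ (1 * nat (x\<^sup>2)) = (-1) ^ nat \<bar>x\<bar> * q ^ nat (x\<^sup>2)"
      unfolding q mult.assoc[symmetric] by simp
  qed simp
  finally have "agree (2 * M) (phi 1 * (\<Prod>k=1..2*M. 1 + q ^ k))
      ((\<Prod>k=1..2*M. 1 + q ^ k) * (\<Sum>x\<in>?F. (-1) ^ nat \<bar>x\<bar> * q ^ nat (x\<^sup>2)))"
    unfolding mult.commute[of "phi 1"] by (intro agree_mult[OF agree_refl])
  also have "agree (2 * M) \<dots> ((\<Prod>k=1..2*M. 1 - q ^ k) + 2 * (\<Sum>s=1..2*M. 0))"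
    unfolding finite_Gauss_square_identity
  proof (intro agree_add agree_mult[OF agree_refl] agree_sum agree_refl)
    fix s assume "s \<in> {1..2 * M}"
    then have "1 * (2 * M + 1) \<le> s * (2 * M + 1)" by (intro mult_le_mono) auto
    then show "agree (2 * M) ((-1) ^ s * (\<Prod>k=s+1..2*M. 1 - q ^ k) * (\<Prod>k=1..<s. 1 + q ^ k) * q ^ (s * (2 * M + 1))) 0"
      unfolding q by (intro agree_mult_right agree_0_X_power) simp
  qed
  finally show ?thesis
    unfolding prod_pair q by simp
qed

text \<open>Here q = X^2, so degree 2 M in X needs only the finite identity with M factors, and the
  alternating signs stay.\<close>

lemma agree_phi_alt_2:
  "agree (2 * M) (phi_alt 2 * (\<Prod>j=1..M. 1 + fps_X ^ (2 * j))) (\<Prod>j=1..M. 1 - fps_X ^ (2 * j) :: 'a::comm_ring_1 fps)"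
proof -
  define q :: "'a fps" where "q = fps_X ^ 2"
  have q: "q ^ k = fps_X ^ (2 * k)" for k
    unfolding q_def by (simp add: power_mult)
  let ?F = "{-int M..int M}"
  have "agree (2 * M) (phi_alt 2 :: 'a fps) (\<Sum>x\<in>?F. fps_const (sg x) * fps_X ^ (2 * nat (x\<^sup>2)))"
    unfolding phi_alt_def
  proof (rule gf_agree_sum)
    fix x :: int assume "2 * nat (x\<^sup>2) \<le> 2 * M"
    then show "x \<in> ?F" using sq_bound[of x] by (auto simp: abs_le_iff)
  qed auto
  also have "(\<Sum>x\<in>?F. fps_const (sg x) * fps_X ^ (2 * nat (x\<^sup>2))) = (\<Sum>x\<in>?F. (-1) ^ nat \<bar>x\<bar> * q ^ nat (x\<^sup>2))"
    unfolding q sg_eq_power fps_const_sg ..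
  finally have "agree (2 * M) (phi_alt 2 * (\<Prod>k=1..M. 1 + q ^ k))
      ((\<Prod>k=1..M. 1 + q ^ k) * (\<Sum>x\<in>?F. (-1) ^ nat \<bar>x\<bar> * q ^ nat (x\<^sup>2)))"
    unfolding mult.commute[of "phi_alt 2"] by (intro agree_mult[OF agree_refl])
  also have "agree (2 * M) \<dots> ((\<Prod>k=1..M. 1 - q ^ k) + 2 * (\<Sum>s=1..M. 0))"
    unfolding finite_Gauss_square_identity
  proof (intro agree_add agree_mult[OF agree_refl] agree_sum agree_refl)
    fix s assume "s \<in> {1..M}"
    then have "1 * (M + 1) \<le> s * (M + 1)" by (intro mult_le_mono) auto
    then show "agree (2 * M) ((-1) ^ s * (\<Prod>k=s+1..M. 1 - q ^ k) * (\<Prod>k=1..<s. 1 + q ^ k) * q ^ (s * (M + 1))) 0"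
      unfolding q by (intro agree_mult_right agree_0_X_power) simp
  qed
  finally show ?thesis
    unfolding q by simp
qed

lemma agree_psi:
  assumes "M > 0"
  shows "agree (2 * M) (psi 1 * (\<Prod>j<M. 1 - fps_X ^ (2 * j + 1))) (2 * (\<Prod>j=1..M. 1 - fps_X ^ (2 * j)) :: 'a::comm_ring_1 fps)"
proof -
  \<comment> \<open>The interval is invariant under the reflection of k to -1 - k, which fixes
    \<open>tri\<close>; each of its halves reproduces the sum over k < 2 M of the finite
    identity.\<close>
  let ?F = "{-int (2 * M)..<int (2 * M)}"
  let ?f = "\<lambda>k. fps_X ^ (k * (k + 1) div 2) :: 'a fps"
  have "agree (2 * M) (psi 1 :: 'a fps) (\<Sum>k\<in>?F. fps_const 1 * fps_X ^ (1 * tri k))"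
    unfolding psi_def
  proof (rule gf_agree_sum)
    fix k :: int assume *: "1 * tri k \<le> 2 * M"
    have "m < 2 * int M" if "0 \<le> m" "tri m \<le> 2 * M" for m
    proof (rule ccontr)
      assume "\<not> m < 2 * int M"
      then have "(2 * int M) * (2 * int M + 1) \<le> m * (m + 1)" using that by (intro mult_mono) auto
      also have "\<dots> \<le> 2 * (2 * int M)" using that(2) two_int_tri[of m] by linarith
      finally show False using assms by (simp add: mult_le_cancel_left)
    qed
    from this[of k] this[of "-1-k"] * show "k \<in> ?F"
      by (cases "0 \<le> k") (auto simp: tri_reflect)
  qed auto
  also have "(\<Sum>k\<in>?F. fps_const 1 * fps_X ^ (1 * tri k)) = (\<Sum>k\<in>?F. fps_X ^ tri k :: 'a fps)"
    by simp
  also have "?F = int ` {..<2 * M} \<union> (\<lambda>k. - 1 - int k) ` {..<2 * M}"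
  proof (intro equalityI subsetI)
    fix k assume k: "k \<in> ?F"
    show "k \<in> int ` {..<2 * M} \<union> (\<lambda>k. - 1 - int k) ` {..<2 * M}"
    proof (cases "0 \<le> k")
      case True then have "k = int (nat k)" "nat k < 2 * M" using k by auto
      then show ?thesis by blast
    next
      case False then have "k = - 1 - int (nat (- 1 - k))" "nat (- 1 - k) < 2 * M" using k by auto
      then show ?thesis by blast
    qed
  qed auto
  also have "(\<Sum>k\<in>\<dots>. fps_X ^ tri k :: 'a fps) =
      (\<Sum>k\<in>int ` {..<2 * M}. fps_X ^ tri k) + (\<Sum>k\<in>(\<lambda>k. - 1 - int k) ` {..<2 * M}. fps_X ^ tri k)"
    by (rule sum.union_disjoint) auto
  also have "(\<Sum>k\<in>int ` {..<2 * M}. fps_X ^ tri k) = (\<Sum>k<2 * M. ?f k)"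
    by (subst sum.reindex) (auto simp: tri_def inj_on_def nat_div_distrib nat_mult_distrib nat_add_distrib intro!: sum.cong)
  also have "(\<Sum>k\<in>(\<lambda>k. - 1 - int k) ` {..<2 * M}. fps_X ^ tri k) = (\<Sum>k<2 * M. ?f k)"
    by (subst sum.reindex) (auto simp: tri_reflect, auto simp: tri_def inj_on_def nat_div_distrib nat_mult_distrib nat_add_distrib intro!: sum.cong)
  finally have "agree (2 * M) (psi 1 * (\<Prod>j<M. 1 - fps_X ^ (2 * j + 1)))
      (((\<Sum>k<2 * M. ?f k) + (\<Sum>k<2 * M. ?f k)) * (\<Prod>j<M. 1 - fps_X ^ (2 * j + 1)))"
    by (rule agree_mult[OF _ agree_refl])
  also have "\<dots> = 2 * ((\<Prod>j<M. 1 - fps_X ^ (2 * j + 1)) * (\<Sum>k<2 * M. ?f k))"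
    by (simp add: mult_ac flip: mult_2)
  \<comment> \<open>Up to degree 2 M only the summand s = 0 survives; \<open>M > 0\<close>
    guarantees that it occurs.\<close>
  also have "agree (2 * M) \<dots> (2 * (\<Sum>s<M. if s = 0 then \<Prod>j=1..M. 1 - fps_X ^ (2 * j) else 0))"
    unfolding finite_Gauss_triangular_identity
  proof (intro agree_mult[OF agree_refl] agree_sum)
    fix s
    show "agree (2 * M) ((\<Prod>k=s+1..M. 1 - fps_X ^ (2 * k)) * (\<Prod>k<s. 1 - fps_X ^ (2 * k + 1)) * fps_X ^ (s * (2 * M + 1)))
        (if s = 0 then \<Prod>j=1..M. 1 - fps_X ^ (2 * j) else 0 :: 'a fps)"
    proof (cases "s = 0")
      case False
      then have "1 * (2 * M + 1) \<le> s * (2 * M + 1)" by (intro mult_le_mono) auto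
      then show ?thesis using False agree_0_X_power[of "2 * M" "s * (2 * M + 1)"] by simp
    qed simp
  qed
  finally show ?thesis
    using assms by simp
qed

lemma agree_all: "(\<And>M. M > 0 \<Longrightarrow> agree (2 * M) f g) \<Longrightarrow> f = g"
proof (rule fps_ext)
  fix n assume "\<And>M. M > 0 \<Longrightarrow> agree (2 * M) f g"
  from this[of "Suc n"] show "f $ n = g $ n" by (simp add: agree_def)
qed

text \<open>In the limit, the relations collected in the proof read P = c / a, D = d / a, phi = a b
  / (c d), phi_alt 2 = b / d and psi = 2 b / c, where a, b, c, d are the truncated products;
  everything cancels.\<close>

lemma
  fixes P D :: "'a::comm_ring_1 fps"
  defines "P \<equiv> Abs_fps (\<lambda>n. (-1) ^ n * of_nat (overp_odd n))"
    and "D \<equiv> Abs_fps (\<lambda>n. (-1) ^ n * of_nat (ped n))"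
  shows overp_odd_phi: "P * phi 1 = phi_alt 2"
    and ped_phi: "2 * D * phi 1 = psi 1"
proof -
  define a c b d :: "nat \<Rightarrow> 'a fps"
    where "a M = (\<Prod>j<M. 1 + fps_X ^ (2 * j + 1))" and "c M = (\<Prod>j<M. 1 - fps_X ^ (2 * j + 1))"
      and "b M = (\<Prod>j=1..M. 1 - fps_X ^ (2 * j))" and "d M = (\<Prod>j=1..M. 1 + fps_X ^ (2 * j))" for M
  note defs = a_def c_def b_def d_def
  have P: "agree (2 * M) (P * a M) (c M)" and D: "agree (2 * M) (D * a M) (d M)"
    and phi: "agree (2 * M) (phi 1 * (c M * d M)) (a M * b M)"
    and alt: "agree (2 * M) (b M) (phi_alt 2 * d M)" for M
    unfolding P_def D_def defs
    by (rule agree_overp agree_ped agree_phi agree_phi_alt_2[THEN agree_sym])+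
  have psi: "agree (2 * M) (2 * b M) (psi 1 * c M)" if "M > 0" for M
    unfolding defs by (rule agree_psi[OF that, THEN agree_sym])
  have unit: "(a M * (c M * d M)) $ 0 = 1" for M
    by (simp add: defs prod_nth_0)
  show "P * phi 1 = phi_alt 2"
  proof (rule agree_all, rule agree_cancel[OF unit])
    fix M
    have "agree (2 * M) (P * a M * (phi 1 * (c M * d M))) (c M * (a M * b M))"
      by (rule agree_mult[OF P phi])
    also have "agree (2 * M) \<dots> (c M * (a M * (phi_alt 2 * d M)))"
      by (intro agree_mult agree_refl alt)
    finally show "agree (2 * M) (P * phi 1 * (a M * (c M * d M))) (phi_alt 2 * (a M * (c M * d M)))"
      by (simp add: mult_ac)
  qed
  show "2 * D * phi 1 = psi 1"
  proof (rule agree_all, rule agree_cancel[OF unit])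
    fix M :: nat assume "M > 0"
    have "agree (2 * M) (2 * (D * a M * (phi 1 * (c M * d M)))) (2 * (d M * (a M * b M)))"
      by (rule agree_mult[OF agree_refl agree_mult[OF D phi]])
    also have "2 * (d M * (a M * b M)) = d M * a M * (2 * b M)"
      by (simp add: mult_ac)
    also have "agree (2 * M) \<dots> (d M * a M * (psi 1 * c M))"
      by (rule agree_mult[OF agree_refl psi[OF \<open>M > 0\<close>]])
    finally show "agree (2 * M) (2 * D * phi 1 * (a M * (c M * d M))) (psi 1 * (a M * (c M * d M)))"
      by (simp add: mult_ac)
  qed
qed

section \<open>Arithmetic in characteristic 3\<close>

definition spread3 :: "'a::comm_ring_1 fps \<Rightarrow> 'a fps" where
  "spread3 f = Abs_fps (\<lambda>n. if 3 dvd n then f $ (n div 3) else 0)"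

definition section3 :: "nat \<Rightarrow> 'a::comm_ring_1 fps \<Rightarrow> 'a fps" where
  "section3 r f = Abs_fps (\<lambda>n. f $ (3 * n + r))"

lemma section3_mult_spread3:
  assumes "r < 3"
  shows "section3 r (f * spread3 g) = section3 r f * g"
proof (rule fps_ext)
  fix n
  have "section3 r (f * spread3 g) $ n = (\<Sum>j=0..3 * n + r. spread3 g $ j * f $ (3 * n + r - j))"
    by (simp add: section3_def mult.commute[of f] fps_mult_nth)
  also have "\<dots> = (\<Sum>j\<in>(\<lambda>i. 3 * i) ` {0..n}. spread3 g $ j * f $ (3 * n + r - j))"
  proof (rule sum.mono_neutral_right)
    show "\<forall>j\<in>{0..3 * n + r} - (\<lambda>i. 3 * i) ` {0..n}. spread3 g $ j * f $ (3 * n + r - j) = 0"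
      using assms by (auto simp: spread3_def elim!: dvdE)
  qed auto
  also have "\<dots> = (\<Sum>j=0..n. g $ j * f $ (3 * (n - j) + r))"
    by (subst sum.reindex) (auto simp: inj_on_def spread3_def diff_mult_distrib2 intro!: sum.cong)
  also have "\<dots> = (section3 r f * g) $ n"
    by (simp add: section3_def mult.commute[of _ g] fps_mult_nth)
  finally show "section3 r (f * spread3 g) $ n = (section3 r f * g) $ n" .
qed

lemma spread3_gf: "spread3 (gf S Q w) = gf S (\<lambda>i. 3 * Q i) w"
proof (rule fps_ext)
  fix n
  show "spread3 (gf S Q w) $ n = gf S (\<lambda>i. 3 * Q i) w $ n"
  proof (cases "3 dvd n")
    case True
    then have "{i \<in> S. Q i = n div 3} = {i \<in> S. 3 * Q i = n}" by auto
    with True show ?thesis by (simp add: spread3_def gf_nth)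
  next
    case False
    then have empty: "{i \<in> S. 3 * Q i = n} = {}" by auto
    show ?thesis using False by (simp add: spread3_def gf_nth empty)
  qed
qed

lemma cube_add:
  fixes x y :: "'a::comm_ring_1"
  assumes "(3::'a) = 0"
  shows "(x + y) ^ 3 = x ^ 3 + y ^ 3"
proof -
  have "(x + y) ^ 3 = x ^ 3 + y ^ 3 + 3 * (x ^ 2 * y + x * y ^ 2)"
    by (simp add: power3_eq_cube power2_eq_square algebra_simps)
  then show ?thesis using assms by simp
qed

lemma of_int_cube:
  assumes "(3::'a::comm_ring_1) = 0"
  shows "(of_int k :: 'a) ^ 3 = of_int k"
proof -
  have "k mod 3 = 0 \<or> k mod 3 = 1 \<or> k mod 3 = 2" by presburger
  moreover have "(k ^ 3) mod 3 = ((k mod 3) ^ 3) mod 3" by (simp add: power_mod)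
  ultimately have "(k ^ 3) mod 3 = k mod 3" by (elim disjE) simp_all
  then obtain m where "k ^ 3 - k = 3 * m"
    by (metis dvdE mod_eq_dvd_iff)
  then have "of_int (k ^ 3) - of_int k = (3 * of_int m :: 'a)"
    by (metis of_int_diff of_int_mult of_int_numeral)
  then show ?thesis using assms by simp
qed

text \<open>Cubing is additive when 3 = 0, and by Fermat it fixes every coefficient that comes from
  an integer. Additivity is only available for finite sums, so the series is first truncated to the
  polynomial \<open>p\<close>.\<close>

lemma fps_cube_eq_spread3:
  fixes f :: "'a::comm_ring_1 fps"
  assumes three: "(3::'a) = 0" and int: "\<And>n. f $ n \<in> \<int>"
  shows "f ^ 3 = spread3 f"
proof (rule fps_ext)
  fix n
  have three': "(3 :: 'a fps) = 0"
    using three by (simp add: numeral_fps_const)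
  have sum_cube: "(\<Sum>i\<in>A. g i) ^ 3 = (\<Sum>i\<in>A. g i ^ 3)" if "finite A" for A :: "nat set" and g :: "nat \<Rightarrow> 'a fps"
    using that by induction (simp_all add: cube_add[OF three'])
  have coeff_cube: "(f $ i) ^ 3 = f $ i" for i
    using int[of i] by (auto simp: of_int_cube[OF three] elim!: Ints_cases)
  define p where "p = (\<Sum>i\<le>n. fps_const (f $ i) * fps_X ^ i)"
  have "agree n f p"
    by (auto simp: agree_def p_def fps_sum_nth if_distrib[of "\<lambda>x. _ * x"] cong: if_cong)
  then have "agree n (f ^ 3) (p ^ 3)"
    unfolding power3_eq_cube by (intro agree_mult)
  then have "f ^ 3 $ n = p ^ 3 $ n"
    by (simp add: agree_def)
  also have "p ^ 3 = (\<Sum>i\<le>n. fps_const (f $ i) * fps_X ^ (3 * i))"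
    unfolding p_def sum_cube[OF finite_atMost] power_mult_distrib
    by (simp add: fps_const_power coeff_cube mult.commute flip: power_mult)
  also have "\<dots> $ n = (\<Sum>i\<le>n. if 3 * i = n then f $ i else 0)"
    by (auto simp: fps_sum_nth intro!: sum.cong)
  also have "\<dots> = spread3 f $ n"
  proof (cases "3 dvd n")
    case True
    then obtain m where "n = 3 * m" by blast
    then show ?thesis by (simp add: spread3_def)
  next
    case False
    then have "3 * i \<noteq> n" for i by auto
    then show ?thesis using False by (simp add: spread3_def)
  qed
  finally show "f ^ 3 $ n = spread3 f $ n" .
qed

lemma sg_in_Ints: "sg x \<in> \<int>"
  by (simp add: sg_def)

lemma
  assumes "(3::'a::comm_ring_1) = 0"
  shows phi_cube: "phi m ^ 3 = (phi (3 * m) :: 'a fps)"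
    and phi_alt_cube: "phi_alt m ^ 3 = (phi_alt (3 * m) :: 'a fps)"
    and psi_cube: "psi m ^ 3 = (psi (3 * m) :: 'a fps)"
proof -
  have "phi m $ n \<in> (\<int> :: 'a set)" "phi_alt m $ n \<in> (\<int> :: 'a set)" "psi m $ n \<in> (\<int> :: 'a set)" for n
    unfolding phi_def phi_alt_def psi_def gf_nth by (intro Ints_sum; simp add: sg_in_Ints)+
  then show "phi m ^ 3 = (phi (3 * m) :: 'a fps)" "phi_alt m ^ 3 = (phi_alt (3 * m) :: 'a fps)"
    "psi m ^ 3 = (psi (3 * m) :: 'a fps)"
    by (simp_all add: fps_cube_eq_spread3[OF assms]) (simp_all add: phi_def phi_alt_def psi_def spread3_gf mult.assoc)
qed

section \<open>Quadratic relations between theta series\<close>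

lemma gf_Un_disjoint:
  assumes "finite_fibres (S \<union> T) Q" "S \<inter> T = {}"
  shows "gf (S \<union> T) Q w = gf S Q w + gf T Q w"
proof (rule fps_ext)
  fix n
  have "{i \<in> S \<union> T. Q i = n} = {i \<in> S. Q i = n} \<union> {i \<in> T. Q i = n}" by auto
  moreover have "finite {i \<in> S. Q i = n}" "finite {i \<in> T. Q i = n}"
    using finite_fibresD[OF assms(1), of n] by (auto elim: rev_finite_subset)
  ultimately show "gf (S \<union> T) Q w $ n = (gf S Q w + gf T Q w) $ n"
    using assms(2) unfolding gf_nth fps_add_nth by (metis (no_types, lifting) sum.union_disjoint disjoint_iff mem_Collect_eq)
qed

text \<open>Parametrises the sublattice of index 2 on which the sums of two squares and of two
  triangular numbers both become diagonal.\<close>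

lemma bij_betw_sum_diff:
  "bij_betw (\<lambda>(a, b). (a + b, a - b)) (UNIV \<times> UNIV) {(i, j). even (i - j :: int)}"
proof (rule bij_betwI[where g = "\<lambda>(i, j). ((i + j) div 2, (i - j) div 2)"])
  fix y :: "int \<times> int" assume "y \<in> {(i, j). even (i - j)}"
  then obtain i j where "y = (i, j)" "even (i - j)" by auto
  moreover from this have "(i + j) div 2 + (i - j) div 2 = i" "(i + j) div 2 - (i - j) div 2 = j"
    by presburger+
  ultimately show "(case case y of (i, j) \<Rightarrow> ((i + j) div 2, (i - j) div 2) of (a, b) \<Rightarrow> (a + b, a - b)) = y"
    by simp
qed auto

text \<open>Reflecting j to -1 - j identifies the pairs of opposite parity with those of equal
  parity, hence the factor 2. On the latter, i = k + m and j = k - m give tri i + tri j = 2 tri k +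
  m^2.\<close>

lemma psi_square: "psi 1 ^ 2 = 2 * phi 1 * (psi 2 :: 'a::comm_ring_1 fps)"
proof -
  let ?Q = "\<lambda>(i, j). tri i + tri j"
  let ?E = "{(i, j). even (i - j)} :: (int \<times> int) set"
  let ?O = "{(i, j). odd (i - j)} :: (int \<times> int) set"
  have ff: "finite_fibres UNIV tri" using finite_fibres_tri[of 1] by simp
  have Un: "?E \<union> ?O = UNIV \<times> UNIV" by auto
  have ffQ: "finite_fibres (UNIV \<times> UNIV) ?Q"
    using finite_fibres_Times[OF ff ff] by simp
  have "psi 1 ^ 2 = (gf (UNIV \<times> UNIV) ?Q (\<lambda>_. 1) :: 'a fps)"
    using gf_mult[OF ff ff, of "\<lambda>_. 1 :: 'a" "\<lambda>_. 1"] by (simp add: psi_def power2_eq_square case_prod_unfold)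
  also have "\<dots> = gf ?E ?Q (\<lambda>_. 1) + gf ?O ?Q (\<lambda>_. 1)"
    unfolding Un[symmetric] by (rule gf_Un_disjoint) (use ffQ Un in auto)
  also have "gf ?O ?Q (\<lambda>_. 1 :: 'a) = gf ?E ?Q (\<lambda>_. 1)"
  proof (rule gf_reindex)
    show "bij_betw (\<lambda>(i, j). (i, - 1 - j)) ?E ?O"
      by (rule bij_betwI[where g = "\<lambda>(i, j). (i, - 1 - j)"]) auto
  qed (auto simp: tri_reflect)
  also have "gf ?E ?Q (\<lambda>_. 1 :: 'a) = gf (UNIV \<times> UNIV) (\<lambda>(k, m). 2 * tri k + 1 * nat (m\<^sup>2)) (\<lambda>_. 1)"
  proof (rule gf_reindex[OF bij_betw_sum_diff])
    show "?Q (case x of (k, m) \<Rightarrow> (k + m, k - m)) = (case x of (k, m) \<Rightarrow> 2 * tri k + 1 * nat (m\<^sup>2))" for x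
    proof -
      obtain k m where x: "x = (k, m)" by fastforce
      have "2 * (int (tri (k + m)) + int (tri (k - m))) = 2 * (m\<^sup>2 + 2 * int (tri k))"
        unfolding distrib_left two_int_tri mult.left_commute[of 2 2] by (simp add: power2_eq_square algebra_simps)
      then have "int (tri (k + m) + tri (k - m)) = int (2 * tri k + 1 * nat (m\<^sup>2))"
        by simp
      then show ?thesis unfolding of_nat_eq_iff x by simp
    qed
  qed auto
  also have "\<dots> = psi 2 * phi 1"
    unfolding phi_def psi_def
    by (subst gf_mult[OF finite_fibres_tri finite_fibres_square]) (simp_all add: case_prod_unfold)
  finally show ?thesis by (simp add: mult_ac flip: mult_2)
qed

text \<open>Swapping the coordinates reverses the sign of each pair of opposite parity, so these
  cancel. On the other pairs x = a + b and y = a - b give x^2 + y^2 = 2 a^2 + 2 b^2 with sign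
  \<open>sg a * sg b\<close>.\<close>

lemma phi_mult_phi_alt:
  assumes "(3::'a::comm_ring_1) = 0"
  shows "phi 1 * phi_alt 1 = (phi_alt 2 ^ 2 :: 'a fps)"
proof -
  let ?Q = "\<lambda>(x, y). 1 * nat (x\<^sup>2) + 1 * nat (y\<^sup>2)"
  let ?w = "\<lambda>(x, y). 1 * sg y :: 'a"
  let ?E = "{(i, j). even (i - j)} :: (int \<times> int) set"
  let ?O = "{(i, j). odd (i - j)} :: (int \<times> int) set"
  have Un: "?E \<union> ?O = UNIV \<times> UNIV" by auto
  have ffQ: "finite_fibres (UNIV \<times> UNIV) ?Q"
    by (rule finite_fibres_Times[OF finite_fibres_square finite_fibres_square]) auto
  have "phi 1 * phi_alt 1 = gf (UNIV \<times> UNIV) ?Q ?w"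
    unfolding phi_def phi_alt_def by (rule gf_mult[OF finite_fibres_square finite_fibres_square]) auto
  also have "\<dots> = gf ?E ?Q ?w + gf ?O ?Q ?w"
    unfolding Un[symmetric] by (rule gf_Un_disjoint) (use ffQ Un in auto)
  also have "gf ?O ?Q ?w = 0"
  proof -
    have "gf ?O ?Q ?w = gf ?O ?Q (\<lambda>x. - ?w x)"
    proof (rule gf_reindex)
      show "bij_betw (\<lambda>(i, j). (j, i)) ?O ?O"
        by (rule bij_betwI[where g = "\<lambda>(i, j). (j, i)"]) auto
    qed (auto simp: sg_def)
    also have "\<dots> = - gf ?O ?Q ?w"
      by (rule fps_ext) (simp add: gf_nth sum_negf)
    finally have "gf ?O ?Q ?w + gf ?O ?Q ?w = 0" by (simp add: eq_neg_iff_add_eq_0)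
    \<comment> \<open>The cancellation only shows that twice the series is 0; characteristic 3
      allows the division by 2.\<close>
    moreover have "gf ?O ?Q ?w = 3 * gf ?O ?Q ?w - (gf ?O ?Q ?w + gf ?O ?Q ?w)"
      by (simp add: algebra_simps)
    moreover have "(3 :: 'a fps) = 0" using assms by (simp add: numeral_fps_const)
    ultimately show ?thesis by simp
  qed
  also have "gf ?E ?Q ?w = gf (UNIV \<times> UNIV) (\<lambda>(a, b). 2 * nat (a\<^sup>2) + 2 * nat (b\<^sup>2)) (\<lambda>(a, b). sg a * sg b)"
  proof (rule gf_reindex[OF bij_betw_sum_diff])
    show "?Q (case x of (a, b) \<Rightarrow> (a + b, a - b)) = (case x of (a, b) \<Rightarrow> 2 * nat (a\<^sup>2) + 2 * nat (b\<^sup>2))" for x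
    proof -
      obtain a b where x: "x = (a, b)" by fastforce
      have "int (1 * nat ((a + b)\<^sup>2) + 1 * nat ((a - b)\<^sup>2)) = int (2 * nat (a\<^sup>2) + 2 * nat (b\<^sup>2))"
        by simp (simp add: power2_eq_square algebra_simps)
      then show ?thesis unfolding of_nat_eq_iff x by simp
    qed
  qed (auto simp: sg_diff)
  also have "\<dots> = phi_alt 2 * phi_alt 2"
    unfolding phi_alt_def by (rule gf_mult[OF finite_fibres_square finite_fibres_square, symmetric]) auto
  finally show ?thesis by (simp add: power2_eq_square)
qed

section \<open>Ternary theta series restricted to an isotropic line modulo 3\<close>

lemma
  fixes w :: "'i \<Rightarrow> 'a::comm_ring_1"
  assumes "finite_fibres S Q" "finite_fibres T R" "finite_fibres U P"
  shows gf_mult3: "gf S Q w * gf T R v * gf U P u =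
      gf ((S \<times> T) \<times> U) (\<lambda>((i, j), k). Q i + R j + P k) (\<lambda>((i, j), k). w i * v j * u k)"
    and finite_fibres_Times3: "finite_fibres ((S \<times> T) \<times> U) (\<lambda>((i, j), k). Q i + R j + P k)"
  unfolding gf_mult[OF assms(1,2)] gf_mult[OF finite_fibres_Times[OF assms(1,2)] assms(3)]
  using finite_fibres_Times[OF finite_fibres_Times[OF assms(1,2)] assms(3)]
  by (simp_all add: case_prod_unfold)

text \<open>
  The conic \<open>x\<^sup>2 + y\<^sup>2 + 2 z\<^sup>2 = 0\<close> over the field with three elements has four points, which the
  sign change of \<open>z\<close> and the swap of \<open>x\<close> and \<open>y\<close> permute transitively. Summing over the four
  lines counts the line through \<open>(1, 0, 1)\<close> once modulo 3.
\<close>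

lemma sum_conic_mod_3:
  fixes Z :: "int \<Rightarrow> int" and w :: "(int \<times> int) \<times> int \<Rightarrow> 'a::comm_ring_1"
  assumes three: "(3::'a) = 0" and fin: "finite T"
    and conic: "\<And>x y z. ((x, y), z) \<in> T \<Longrightarrow> 3 dvd x\<^sup>2 + y\<^sup>2 + 2 * (Z z)\<^sup>2"
    and swap: "\<And>x y z. ((x, y), z) \<in> T \<Longrightarrow> ((y, x), z) \<in> T"
    and neg: "\<And>x y z. ((x, y), z) \<in> T \<Longrightarrow> ((x, y), \<sigma> z) \<in> T"
    and Z_neg: "\<And>z. Z (\<sigma> z) = - Z z" and neg_neg: "\<And>z. \<sigma> (\<sigma> z) = z"
    and w_swap: "\<And>x y z. w ((y, x), z) = w ((x, y), z)"
    and w_neg: "\<And>x y z. w ((x, y), \<sigma> z) = w ((x, y), z)"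
  shows "sum w T = sum w {t \<in> T. case t of ((x, y), z) \<Rightarrow> 3 dvd y \<and> 3 dvd x - Z z}"
proof -
  \<comment> \<open>\<open>A\<close> is a full line, including the vectors divisible by 3, which lie
    on all four lines. The other three sets exclude these vectors, which makes the union
    disjoint.\<close>
  define A where "A = {t \<in> T. case t of ((x, y), z) \<Rightarrow> 3 dvd y \<and> 3 dvd x - Z z}"
  define B where "B = {t \<in> T. case t of ((x, y), z) \<Rightarrow> \<not> 3 dvd x \<and> 3 dvd y \<and> 3 dvd x + Z z}"
  define C where "C = {t \<in> T. case t of ((x, y), z) \<Rightarrow> \<not> 3 dvd y \<and> 3 dvd x \<and> 3 dvd y + Z z}"
  define D where "D = {t \<in> T. case t of ((x, y), z) \<Rightarrow> \<not> 3 dvd y \<and> 3 dvd x \<and> 3 dvd y - Z z}"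
  note defs = A_def B_def C_def D_def
  have cover: "3 dvd y \<and> 3 dvd x - c \<or> \<not> 3 dvd x \<and> 3 dvd y \<and> 3 dvd x + c \<or>
      \<not> 3 dvd y \<and> 3 dvd x \<and> 3 dvd y + c \<or> \<not> 3 dvd y \<and> 3 dvd x \<and> 3 dvd y - c"
    if "3 dvd x\<^sup>2 + y\<^sup>2 + 2 * c\<^sup>2" for x y c :: int
  proof -
    have "((x mod 3)\<^sup>2 + (y mod 3)\<^sup>2 + 2 * (c mod 3)\<^sup>2) mod 3 = (x\<^sup>2 + y\<^sup>2 + 2 * c\<^sup>2) mod 3"
      unfolding cong_def[symmetric] by (intro cong_add cong_mult cong_pow) simp_all
    also have "\<dots> = 0"
      using that by (simp only: dvd_eq_mod_eq_0)
    finally have "((x mod 3)\<^sup>2 + (y mod 3)\<^sup>2 + 2 * (c mod 3)\<^sup>2) mod 3 = 0" .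
    moreover have "x mod 3 = 0 \<or> x mod 3 = 1 \<or> x mod 3 = 2" "y mod 3 = 0 \<or> y mod 3 = 1 \<or> y mod 3 = 2"
      "c mod 3 = 0 \<or> c mod 3 = 1 \<or> c mod 3 = 2"
      by presburger+
    moreover have "3 dvd x - c \<longleftrightarrow> (x mod 3 - c mod 3) mod 3 = 0" "3 dvd x + c \<longleftrightarrow> (x mod 3 + c mod 3) mod 3 = 0"
      "3 dvd y - c \<longleftrightarrow> (y mod 3 - c mod 3) mod 3 = 0" "3 dvd y + c \<longleftrightarrow> (y mod 3 + c mod 3) mod 3 = 0"
      "3 dvd x \<longleftrightarrow> x mod 3 = 0" "3 dvd y \<longleftrightarrow> y mod 3 = 0"
      by presburger+
    ultimately show ?thesis
      by (elim disjE) simp_all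
  qed
  have "T = A \<union> (B \<union> (C \<union> D))"
  proof
    show "T \<subseteq> A \<union> (B \<union> (C \<union> D))"
    proof
      fix t assume t: "t \<in> T"
      obtain x y z where xyz: "t = ((x, y), z)" by (metis surj_pair)
      show "t \<in> A \<union> (B \<union> (C \<union> D))"
        using cover[OF conic[OF t[unfolded xyz]]] t unfolding defs xyz by auto
    qed
  qed (auto simp: defs)
  moreover have "A \<inter> (B \<union> (C \<union> D)) = {}" "B \<inter> (C \<union> D) = {}" "C \<inter> D = {}"
    unfolding defs by (auto; presburger)+
  moreover have "finite A" "finite B" "finite C" "finite D"
    using fin by (auto simp: defs)
  ultimately have "sum w T = sum w A + (sum w B + (sum w C + sum w D))"
    by (simp add: sum.union_disjoint)
  also have "sum w B = sum w C"
  proof -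
    have "bij_betw (\<lambda>((x, y), z). ((y, x), z)) B C"
      by (rule bij_betwI[where g = "\<lambda>((x, y), z). ((y, x), z)"]) (auto simp: B_def C_def intro: swap)
    from sum.reindex_bij_betw[OF this, of w] show ?thesis
      by (simp add: case_prod_unfold w_swap[of "snd (fst _)" "fst (fst _)"])
  qed
  also have "sum w D = sum w C"
  proof -
    have "bij_betw (\<lambda>((x, y), z). ((x, y), \<sigma> z)) C D"
      by (rule bij_betwI[where g = "\<lambda>((x, y), z). ((x, y), \<sigma> z)"]) (auto simp: C_def D_def Z_neg neg_neg intro: neg)
    from sum.reindex_bij_betw[OF this, of w]
    have "(\<Sum>((x, y), z)\<in>C. w ((x, y), \<sigma> z)) = sum w D"
      by (simp add: case_prod_unfold)
    moreover have "(\<Sum>((x, y), z)\<in>C. w ((x, y), \<sigma> z)) = sum w C"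
      by (rule sum.cong) (auto simp: w_neg)
    ultimately show ?thesis
      by simp
  qed
  also have "sum w A + (sum w C + (sum w C + sum w C)) = sum w A + 3 * sum w C"
    by (simp add: algebra_simps)
  finally show ?thesis
    using three by (simp add: A_def)
qed

lemma section3_phi_phi_phi_alt:
  assumes "(3::'a::comm_ring_1) = 0"
  shows "section3 0 (phi 1 * phi 1 * phi_alt 2) = (phi_alt 1 * phi_alt 2 * phi 3 :: 'a fps)"
proof (rule fps_ext)
  fix n
  let ?w = "\<lambda>((x, y), z). (1 * 1) * sg z :: 'a"
  let ?Q = "\<lambda>((x :: int, y :: int), z :: int). 1 * nat (x\<^sup>2) + 1 * nat (y\<^sup>2) + 2 * nat (z\<^sup>2)"
  let ?T = "{t \<in> (UNIV \<times> UNIV) \<times> UNIV. ?Q t = 3 * n + 0}"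
  note ff = finite_fibres_square
  have Q_iff: "?Q ((x, y), z) = m \<longleftrightarrow> x\<^sup>2 + y\<^sup>2 + 2 * z\<^sup>2 = int m" for x y z m
    unfolding of_nat_eq_iff[where 'a = int, symmetric] by simp
  have lhs: "phi 1 * phi 1 * phi_alt 2 = gf ((UNIV \<times> UNIV) \<times> UNIV) ?Q ?w"
    unfolding phi_def phi_alt_def by (rule gf_mult3) (simp_all only: ff zero_less_one zero_less_numeral)
  have rhs: "phi_alt 1 * phi_alt 2 * phi 3 = gf ((UNIV \<times> UNIV) \<times> UNIV)
      (\<lambda>((X, u), v). 1 * nat (X\<^sup>2) + 2 * nat (u\<^sup>2) + 3 * nat (v\<^sup>2)) (\<lambda>((X, u), v). sg X * sg u * 1 :: 'a)"
    unfolding phi_def phi_alt_def by (rule gf_mult3) (simp_all only: ff zero_less_one zero_less_numeral)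
  have fin: "finite ?T"
    by (rule finite_fibresD, rule finite_fibres_Times3) (simp_all only: ff zero_less_one zero_less_numeral)
  have "section3 0 (phi 1 * phi 1 * phi_alt 2) $ n = sum ?w ?T"
    unfolding lhs by (simp add: section3_def gf_nth)
  also have "\<dots> = sum ?w {t \<in> ?T. case t of ((x, y), z) \<Rightarrow> 3 dvd y \<and> 3 dvd x - z}"
  proof (rule sum_conic_mod_3[OF assms fin, where \<sigma> = uminus])
    fix x y z assume "((x, y), z) \<in> ?T"
    then show "3 dvd x\<^sup>2 + y\<^sup>2 + 2 * z\<^sup>2" by (simp only: mem_Collect_eq Q_iff) simp
  qed (auto simp: sg_minus add_ac)
  also have "\<dots> = sum (\<lambda>((X, u), v). sg X * sg u * 1)
      {t \<in> (UNIV \<times> UNIV) \<times> UNIV. (\<lambda>((X, u), v). 1 * nat (X\<^sup>2) + 2 * nat (u\<^sup>2) + 3 * nat (v\<^sup>2)) t = n}"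
    (is "_ = sum ?v ?S")
  \<comment> \<open>The pairs (x, z) with x congruent to z modulo 3 have the basis (1, 1), (2, -1),
    which is orthogonal for x^2 + 2 z^2 with values 3 and 6. After y = 3 v the whole form is 3 (X^2
    + 2 u^2 + 3 v^2).\<close>
  proof (rule sum.reindex_bij_witness[where j = "\<lambda>((x, y), z). (((x + 2 * z) div 3, (x - z) div 3), y div 3)"
        and i = "\<lambda>((X, u), v). ((X + 2 * u, 3 * v), X - u)"])
    fix t assume t: "t \<in> {t \<in> ?T. case t of ((x, y), z) \<Rightarrow> 3 dvd y \<and> 3 dvd x - z}"
    obtain x y z where xyz: "t = ((x, y), z)" by (metis surj_pair)
    from t xyz have "3 dvd x - z" "3 dvd y" by auto
    then obtain u v where u: "x - z = 3 * u" and v: "y = 3 * v" unfolding dvd_def by blast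
    then have x: "x = z + 3 * u" by simp
    have Q: "x\<^sup>2 + y\<^sup>2 + 2 * z\<^sup>2 = int (3 * n)" using t unfolding xyz by (simp add: Q_iff[simplified])
    have X: "(x + 2 * z) div 3 = z + u" "(x - z) div 3 = u" "y div 3 = v" by (simp_all add: x v)
    show "(\<lambda>((X, u), v). ((X + 2 * u, 3 * v), X - u)) ((\<lambda>((x, y), z). (((x + 2 * z) div 3, (x - z) div 3), y div 3)) t) = t"
      by (simp add: xyz X) (simp add: x v)
    have "3 * ((z + u)\<^sup>2 + 2 * u\<^sup>2 + 3 * v\<^sup>2) = 3 * int n"
      using Q by (simp add: x v power2_eq_square algebra_simps)
    then have "int (nat ((z + u)\<^sup>2) + 2 * nat (u\<^sup>2) + 3 * nat (v\<^sup>2)) = int n" by simp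
    then show "(\<lambda>((x, y), z). (((x + 2 * z) div 3, (x - z) div 3), y div 3)) t \<in> ?S"
      unfolding of_nat_eq_iff by (simp add: xyz X)
    show "?v ((\<lambda>((x, y), z). (((x + 2 * z) div 3, (x - z) div 3), y div 3)) t) = ?w t"
      by (simp add: xyz X) (simp add: sg_def)
  next
    fix t assume t: "t \<in> ?S"
    obtain X u v where xyz: "t = ((X, u), v)" by (metis surj_pair)
    have [simp]: "X + 2 * u + 2 * (X - u) = 3 * X" "X + 2 * u - (X - u) = 3 * u" by simp_all
    show "(\<lambda>((x, y), z). (((x + 2 * z) div 3, (x - z) div 3), y div 3)) ((\<lambda>((X, u), v). ((X + 2 * u, 3 * v), X - u)) t) = t"
      by (simp add: xyz)
    have "int (nat (X\<^sup>2) + 2 * nat (u\<^sup>2) + 3 * nat (v\<^sup>2)) = int n"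
      using t unfolding of_nat_eq_iff by (simp add: xyz)
    then have "(X + 2 * u)\<^sup>2 + (3 * v)\<^sup>2 + 2 * (X - u)\<^sup>2 = int (3 * n + 0)"
      by simp (simp add: power2_eq_square algebra_simps)
    then show "(\<lambda>((X, u), v). ((X + 2 * u, 3 * v), X - u)) t \<in> {t \<in> ?T. case t of ((x, y), z) \<Rightarrow> 3 dvd y \<and> 3 dvd x - z}"
      unfolding Q_iff[symmetric] by (simp add: xyz)
  qed
  also have "\<dots> = (phi_alt 1 * phi_alt 2 * phi 3) $ n"
    unfolding rhs gf_nth ..
  finally show "section3 0 (phi 1 * phi 1 * phi_alt 2) $ n = (phi_alt 1 * phi_alt 2 * phi 3 :: 'a fps) $ n" .
qed

lemma section3_phi_phi_psi:
  assumes "(3::'a::comm_ring_1) = 0"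
  shows "section3 1 (phi 1 * phi 1 * psi 1) = (psi 2 * psi 1 * phi 3 :: 'a fps)"
proof (rule fps_ext)
  fix n
  let ?w = "\<lambda>((x, y), z). (1 * 1) * 1 :: 'a"
  let ?Q = "\<lambda>((x :: int, y :: int), z :: int). 1 * nat (x\<^sup>2) + 1 * nat (y\<^sup>2) + 1 * tri z"
  let ?T = "{t \<in> (UNIV \<times> UNIV) \<times> UNIV. ?Q t = 3 * n + 1}"
  note ff = finite_fibres_square finite_fibres_tri
  have Q_iff: "?Q ((x, y), z) = m \<longleftrightarrow> 2 * x\<^sup>2 + 2 * y\<^sup>2 + z * (z + 1) = 2 * int m" for x y z m
    unfolding of_nat_eq_iff[where 'a = int, symmetric] two_int_tri[symmetric] by auto
  have lhs: "phi 1 * phi 1 * psi 1 = gf ((UNIV \<times> UNIV) \<times> UNIV) ?Q ?w"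
    unfolding phi_def psi_def by (rule gf_mult3) (simp_all only: ff zero_less_one zero_less_numeral)
  have rhs: "psi 2 * psi 1 * phi 3 = gf ((UNIV \<times> UNIV) \<times> UNIV)
      (\<lambda>((i, j), v). 2 * tri i + 1 * tri j + 3 * nat (v\<^sup>2)) (\<lambda>((X, u), v). 1 * 1 * 1 :: 'a)"
    unfolding phi_def psi_def by (rule gf_mult3) (simp_all only: ff zero_less_one zero_less_numeral)
  have fin: "finite ?T"
    by (rule finite_fibresD, rule finite_fibres_Times3) (simp_all only: ff zero_less_one zero_less_numeral)
  have "section3 1 (phi 1 * phi 1 * psi 1) $ n = sum ?w ?T"
    unfolding lhs by (simp add: section3_def gf_nth)
  also have "\<dots> = sum ?w {t \<in> ?T. case t of ((x, y), z) \<Rightarrow> 3 dvd y \<and> 3 dvd x - (2 * z + 1)}"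
  proof (rule sum_conic_mod_3[OF assms fin, where \<sigma> = "\<lambda>z. - 1 - z" and Z = "\<lambda>z. 2 * z + 1"])
    fix x y z assume "((x, y), z) \<in> ?T"
    then have "2 * x\<^sup>2 + 2 * y\<^sup>2 + z * (z + 1) = 2 * int (3 * n + 1)" by (simp only: mem_Collect_eq Q_iff)
    then have "x\<^sup>2 + y\<^sup>2 + 2 * (2 * z + 1)\<^sup>2 = 3 * (16 * int n + 6 - 5 * x\<^sup>2 - 5 * y\<^sup>2)"
      by (simp add: power2_eq_square algebra_simps)
    then show "3 dvd x\<^sup>2 + y\<^sup>2 + 2 * (2 * z + 1)\<^sup>2" by (simp only: dvd_triv_left)
  qed (auto simp: tri_reflect add_ac)
  also have "\<dots> = sum (\<lambda>((i, j), v). 1 * 1 * 1)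
      {t \<in> (UNIV \<times> UNIV) \<times> UNIV. (\<lambda>((i, j), v). 2 * tri i + 1 * tri j + 3 * nat (v\<^sup>2)) t = n}"
    (is "_ = sum ?v ?S")
  \<comment> \<open>In the odd variables I = 2 i + 1, J = 2 j + 1, Z = 2 z + 1 the substitution is 2
    x = I + J, Z = 2 I - J, and 8 x^2 + Z^2 = 6 I^2 + 3 J^2.\<close>
  proof (rule sum.reindex_bij_witness[where j = "\<lambda>((x, y), z). (((x + z - 1) div 3, (2 * x - z - 2) div 3), y div 3)"
        and i = "\<lambda>((i, j), v). ((i + j + 1, 3 * v), 2 * i - j)"])
    fix t assume t: "t \<in> {t \<in> ?T. case t of ((x, y), z) \<Rightarrow> 3 dvd y \<and> 3 dvd x - (2 * z + 1)}"
    obtain x y z where xyz: "t = ((x, y), z)" by (metis surj_pair)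
    from t xyz have "3 dvd x - (2 * z + 1)" "3 dvd y" by auto
    then obtain u v where u: "x - (2 * z + 1) = 3 * u" and v: "y = 3 * v" unfolding dvd_def by blast
    then have x: "x = 2 * z + 1 + 3 * u" by simp
    have Q: "2 * x\<^sup>2 + 2 * y\<^sup>2 + z * (z + 1) = 2 * int (3 * n + 1)" using t unfolding xyz by (simp add: Q_iff[simplified])
    have X: "(x + z - 1) div 3 = z + u" "(2 * x - z - 2) div 3 = z + 2 * u" "y div 3 = v" by (simp_all add: x v)
    show "(\<lambda>((i, j), v). ((i + j + 1, 3 * v), 2 * i - j)) ((\<lambda>((x, y), z). (((x + z - 1) div 3, (2 * x - z - 2) div 3), y div 3)) t) = t"
      by (simp add: xyz X) (simp add: x v)
    have "3 * (2 * ((z + u) * (z + u + 1)) + (z + 2 * u) * (z + 2 * u + 1) + 6 * v\<^sup>2) = 3 * (2 * int n)"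
      using Q by (simp add: x v power2_eq_square algebra_simps)
    then have "2 * int (2 * tri (z + u) + tri (z + 2 * u) + 3 * nat (v\<^sup>2)) = 2 * int n"
      by (simp add: two_int_tri[symmetric])
    then have "2 * tri (z + u) + tri (z + 2 * u) + 3 * nat (v\<^sup>2) = n"
      by (simp only: mult_cancel_left of_nat_eq_iff) simp
    then show "(\<lambda>((x, y), z). (((x + z - 1) div 3, (2 * x - z - 2) div 3), y div 3)) t \<in> ?S"
      by (simp add: xyz X)
    show "?v ((\<lambda>((x, y), z). (((x + z - 1) div 3, (2 * x - z - 2) div 3), y div 3)) t) = ?w t"
      by (simp add: xyz)
  next
    fix t assume t: "t \<in> ?S"
    obtain i j v where xyz: "t = ((i, j), v)" by (metis surj_pair)
    have [simp]: "i + j + 1 + (2 * i - j) - 1 = 3 * i" "2 * (i + j + 1) - (2 * i - j) - 2 = 3 * j" by simp_all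
    show "(\<lambda>((x, y), z). (((x + z - 1) div 3, (2 * x - z - 2) div 3), y div 3)) ((\<lambda>((i, j), v). ((i + j + 1, 3 * v), 2 * i - j)) t) = t"
      by (simp only: xyz prod.case) simp
    have "2 * int (2 * tri i + tri j + 3 * nat (v\<^sup>2)) = 2 * int n"
      using t by (simp add: xyz)
    then have "2 * (i * (i + 1)) + j * (j + 1) + 6 * v\<^sup>2 = 2 * int n"
      by (simp add: two_int_tri[symmetric])
    then have "2 * (i + j + 1)\<^sup>2 + 2 * (3 * v)\<^sup>2 + (2 * i - j) * (2 * i - j + 1) = 2 * int (3 * n + 1)"
      by (simp add: power2_eq_square algebra_simps)
    then have "((i + j + 1, 3 * v), 2 * i - j) \<in> ?T"
      unfolding Q_iff[symmetric] by simp
    moreover have "3 dvd i + j + 1 - (2 * (2 * i - j) + 1)" by presburger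
    ultimately show "(\<lambda>((i, j), v). ((i + j + 1, 3 * v), 2 * i - j)) t \<in> {t \<in> ?T. case t of ((x, y), z) \<Rightarrow> 3 dvd y \<and> 3 dvd x - (2 * z + 1)}"
      by (simp only: xyz prod.case mem_Collect_eq) simp
  qed
  also have "\<dots> = (psi 2 * psi 1 * phi 3) $ n"
    unfolding rhs gf_nth ..
  finally show "section3 1 (phi 1 * phi 1 * psi 1) $ n = (psi 2 * psi 1 * phi 3 :: 'a fps) $ n" .
qed

text \<open>Multiplying by phi(q)^3, a series in q^3, commutes with taking the section. The section
  lemmas then supply phi(q^3) = phi(q)^3 on the right, which leaves enough factors phi to apply the
  quadratic relations and to cancel the one on the left.\<close>

lemma
  fixes P D :: "'a::comm_ring_1 fps"
  assumes three: "(3::'a) = 0"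
  defines "P \<equiv> Abs_fps (\<lambda>n. (-1) ^ n * of_nat (overp_odd n))"
    and "D \<equiv> Abs_fps (\<lambda>n. (-1) ^ n * of_nat (ped n))"
  shows section3_overp_odd: "section3 0 P = phi 1 * phi_alt 6"
    and section3_ped: "section3 1 D = phi 1 * psi 3"
proof -
  have three': "(3 :: 'a fps) = 0"
    using three by (simp add: numeral_fps_const)
  have phi_3: "spread3 (phi 1) = (phi 3 :: 'a fps)" and phi_cube_1: "phi 1 ^ 3 = (phi 3 :: 'a fps)"
    using phi_cube[OF three, of 1] by (simp_all add: phi_def spread3_gf)
  have P: "P * phi 1 = phi_alt 2" and D: "2 * D * phi 1 = psi 1"
    unfolding P_def D_def by (rule overp_odd_phi ped_phi)+
  have "P * spread3 (phi 1) = P * phi 1 * phi 1 ^ 2"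
    unfolding phi_3 phi_cube_1[symmetric] by (simp add: power3_eq_cube power2_eq_square mult_ac)
  also have "\<dots> = phi 1 * phi 1 * phi_alt 2"
    unfolding P by (simp add: power2_eq_square mult_ac)
  finally have "section3 0 P * phi 1 = phi_alt 1 * phi_alt 2 * phi 3"
    using section3_mult_spread3[of 0 P "phi 1"] section3_phi_phi_phi_alt[OF three] by simp
  also have "\<dots> = (phi 1 * phi_alt 1) * phi_alt 2 * phi 1 * phi 1"
    unfolding phi_cube_1[symmetric] by (simp add: power3_eq_cube mult_ac)
  also have "\<dots> = phi_alt 2 ^ 3 * phi 1 * phi 1"
    unfolding phi_mult_phi_alt[OF three] by (simp add: power3_eq_cube power2_eq_square)
  also have "\<dots> = phi 1 * phi_alt 6 * phi 1"
    unfolding phi_alt_cube[OF three] by (simp add: mult_ac)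
  finally show "section3 0 P = phi 1 * phi_alt 6"
    by (rule fps_cancel[OF phi_nth_0])
  have "2 * D * spread3 (phi 1) = 2 * D * phi 1 * phi 1 ^ 2"
    unfolding phi_3 phi_cube_1[symmetric] by (simp add: power3_eq_cube power2_eq_square mult_ac)
  also have "\<dots> = phi 1 * phi 1 * psi 1"
    unfolding D by (simp add: power2_eq_square mult_ac)
  finally have "section3 1 (2 * D) * phi 1 = psi 2 * psi 1 * phi 3"
    using section3_mult_spread3[of 1 "2 * D" "phi 1"] section3_phi_phi_psi[OF three] by simp
  also have "section3 1 (2 * D) = 2 * section3 1 D"
    unfolding mult_2 by (rule fps_ext) (simp only: section3_def fps_nth_Abs_fps fps_add_nth)
  finally have "2 * (2 * section3 1 D * phi 1) = 2 * (psi 2 * psi 1 * phi 3)"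
    by simp
  also have "\<dots> = (2 * phi 1 * psi 2) * psi 1 * phi 1 * phi 1"
    unfolding phi_cube_1[symmetric] by (simp add: power3_eq_cube mult_ac)
  also have "\<dots> = psi 1 ^ 3 * phi 1 * phi 1"
    unfolding psi_square[symmetric] by (simp add: power3_eq_cube power2_eq_square)
  also have "\<dots> = phi 1 * psi 3 * phi 1"
    unfolding psi_cube[OF three] by (simp add: mult_ac)
  \<comment> \<open>The doubling that \<open>psi_square\<close> required is removed by 4 = 1 in
    characteristic 3.\<close>
  also have "2 * (2 * section3 1 D * phi 1) = section3 1 D * phi 1 + 3 * (section3 1 D * phi 1)"
    by (simp add: algebra_simps)
  also have "\<dots> = section3 1 D * phi 1"
    unfolding three' by simp
  finally show "section3 1 D = phi 1 * psi 3"
    by (rule fps_cancel[OF phi_nth_0])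
qed

section \<open>The congruences with representation numbers, read off in the ring of residues modulo
  3\<close>

lemma cong_3I:
  assumes "(of_int a :: 3) = of_int b" shows "[a = b] (mod 3)"
  using assms by (simp add: of_int_eq_iff_cong_CHAR)

lemma square_mod_12: "x\<^sup>2 mod 12 = (if even x then if 3 dvd x then 0 else 4 else if 3 dvd x then 9 else 1)" for x :: int
proof -
  have "x\<^sup>2 mod 12 = (x mod 12)\<^sup>2 mod 12" by (simp add: power_mod)
  moreover have "even x \<longleftrightarrow> even (x mod 12)" "3 dvd x \<longleftrightarrow> 3 dvd x mod 12" by presburger+
  moreover have "x mod 12 = 0 \<or> x mod 12 = 1 \<or> x mod 12 = 2 \<or> x mod 12 = 3 \<or> x mod 12 = 4 \<or> x mod 12 = 5 \<or>
      x mod 12 = 6 \<or> x mod 12 = 7 \<or> x mod 12 = 8 \<or> x mod 12 = 9 \<or> x mod 12 = 10 \<or> x mod 12 = 11"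
    by presburger
  ultimately show ?thesis by (elim disjE) simp_all
qed

lemma form_mod_12: "(x\<^sup>2 + 6 * y\<^sup>2) mod 12 = (x\<^sup>2 mod 12 + 6 * (y\<^sup>2 mod 12)) mod 12" for x y :: int
  unfolding cong_def[symmetric] by (intro cong_add cong_mult) simp_all

text \<open>This explains \<open>f_sign\<close>: modulo 12 the square x^2 is 0 or 4 for even x and 1
  or 9 for odd x, and 6 y^2 is 0 or 6 by the parity of y. So x + y is odd exactly for the residues
  1, 9, 6 and 10.\<close>

lemma f_sign_eq:
  assumes "x\<^sup>2 + 6 * y\<^sup>2 = int n"
  shows "f_sign n = sg x * sg y"
proof -
  have "int (n mod 12) = (x\<^sup>2 mod 12 + 6 * (y\<^sup>2 mod 12)) mod 12"
    unfolding zmod_int assms[symmetric] of_nat_numeral by (rule form_mod_12)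
  then show ?thesis
    unfolding square_mod_12 f_sign_def sg_def by (auto split: if_splits)
qed

lemma num_reps_diagonal:
  "num_reps n (\<lambda>x y. int a * x\<^sup>2 + int b * y\<^sup>2) =
    card {(x, y) \<in> UNIV \<times> UNIV. a * nat (x\<^sup>2) + b * nat (y\<^sup>2) = n}"
proof -
  have "int a * x\<^sup>2 + int b * y\<^sup>2 = int n \<longleftrightarrow> a * nat (x\<^sup>2) + b * nat (y\<^sup>2) = n" for x y :: int
    unfolding of_nat_eq_iff[where 'a = int, symmetric] by simp
  then show ?thesis by (simp add: num_reps_def)
qed

text \<open>A representation enters the section with sign \<open>sg y\<close>, and undoing the
  substitution of -q gives \<open>(-1) ^ n\<close>, which is \<open>sg x\<close>. Their product is
  the same for all representations.\<close>

lemma overp_odd_cong: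
  "[int (overp_odd (3 * n)) = f_sign n * int (num_reps n (\<lambda>x y. x\<^sup>2 + 6 * y\<^sup>2))] (mod 3)"
proof (rule cong_3I)
  have three: "(3 :: 3) = 0" by simp
  let ?S = "{t \<in> UNIV \<times> UNIV. (\<lambda>(x, y). 1 * nat (x\<^sup>2) + 6 * nat (y\<^sup>2)) t = n}"
  have in_S: "x\<^sup>2 + 6 * y\<^sup>2 = int n" if "(x, y) \<in> ?S" for x y
  proof -
    have "int (nat (x\<^sup>2) + 6 * nat (y\<^sup>2)) = int n" using that unfolding of_nat_eq_iff by simp
    then show ?thesis by simp
  qed
  have "(of_int (int (overp_odd (3 * n))) :: 3) = (-1) ^ n * (section3 0 (Abs_fps (\<lambda>n. (-1) ^ n * of_nat (overp_odd n))) $ n)"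
    by (simp add: section3_def power_mult flip: power_add mult.assoc power_mult_distrib)
  also have "\<dots> = (-1) ^ n * (\<Sum>(x, y)\<in>?S. 1 * sg y)"
    unfolding section3_overp_odd[OF three] phi_def phi_alt_def
    by (subst gf_mult[OF finite_fibres_square finite_fibres_square]) (simp_all add: gf_nth)
  also have "\<dots> = (\<Sum>(x, y)\<in>?S. of_int (f_sign n))"
    unfolding sum_distrib_left
  proof (rule sum.cong[OF refl])
    fix t assume "t \<in> ?S"
    moreover obtain x y where t: "t = (x, y)" by (cases t)
    ultimately have xy: "x\<^sup>2 + 6 * y\<^sup>2 = int n" using in_S[of x y] by (simp only: t)
    have "even (int n) \<longleftrightarrow> even x" unfolding xy[symmetric] by simp
    then have "(-1) ^ n = (sg x :: 3)" by (simp add: sg_def)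
    then show "(-1) ^ n * (case t of (x, y) \<Rightarrow> 1 * sg y) = (case t of (x, y) \<Rightarrow> (of_int (f_sign n) :: 3))"
      by (simp add: t f_sign_eq[OF xy]) (simp add: sg_def)
  qed
  also have "\<dots> = of_int (f_sign n * int (num_reps n (\<lambda>x y. x\<^sup>2 + 6 * y\<^sup>2)))"
    using num_reps_diagonal[of n 1 6] by (simp add: case_prod_unfold)
  finally show "(of_int (int (overp_odd (3 * n))) :: 3) = \<dots>" .
qed

text \<open>Completing the square turns n = x^2 + 3 tri k into 8 n + 3 = 2 (2 x)^2 + 3 (2 k + 1)^2,
  and parity forces every representation of 8 n + 3 into this shape.\<close>

lemma ped_cong:
  "[int (ped (3 * n + 1)) = (-1) ^ (n + 1) * int (num_reps (8 * n + 3) (\<lambda>x y. 2 * x\<^sup>2 + 3 * y\<^sup>2))] (mod 3)"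
proof (rule cong_3I)
  have three: "(3 :: 3) = 0" by simp
  let ?S = "{t \<in> UNIV \<times> UNIV. (\<lambda>(x, k). 1 * nat (x\<^sup>2) + 3 * tri k) t = n}"
  have S_iff: "(x, k) \<in> ?S \<longleftrightarrow> 2 * (2 * x)\<^sup>2 + 3 * (2 * k + 1)\<^sup>2 = int (8 * n + 3)" for x k
  proof -
    have "(x, k) \<in> ?S \<longleftrightarrow> int (nat (x\<^sup>2) + 3 * tri k) = int n" unfolding of_nat_eq_iff by simp
    also have "\<dots> \<longleftrightarrow> 8 * x\<^sup>2 + 12 * (2 * int (tri k)) + 3 = 8 * int n + 3" by auto
    also have "\<dots> \<longleftrightarrow> 2 * (2 * x)\<^sup>2 + 3 * (2 * k + 1)\<^sup>2 = int (8 * n + 3)"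
      unfolding two_int_tri by (simp add: power2_eq_square algebra_simps)
    finally show ?thesis .
  qed
  have "bij_betw (\<lambda>(x, k). (2 * x, 2 * k + 1)) ?S {(x, y). 2 * x\<^sup>2 + 3 * y\<^sup>2 = int (8 * n + 3)}"
  proof (rule bij_betwI[where g = "\<lambda>(x, y). (x div 2, (y - 1) div 2)"])
    have parity: "even x \<and> odd y" if "2 * x\<^sup>2 + 3 * y\<^sup>2 = int (8 * n + 3)" for x y
    proof -
      have "odd (2 * x\<^sup>2 + 3 * y\<^sup>2)" unfolding that by simp
      then have y: "odd y" by simp
      then obtain k where "y = 2 * k + 1" by (elim oddE)
      with that have "2 * x\<^sup>2 = 4 * (2 * int n - 3 * k\<^sup>2 - 3 * k)" by (simp add: power2_eq_square algebra_simps)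
      then have "x\<^sup>2 = 2 * (2 * int n - 3 * k\<^sup>2 - 3 * k)" by simp
      then have "even (x\<^sup>2)" by (simp only: dvd_triv_left)
      then show ?thesis using y by simp
    qed
    show "(\<lambda>(x, k). (2 * x, 2 * k + 1)) \<in> ?S \<rightarrow> {(x, y). 2 * x\<^sup>2 + 3 * y\<^sup>2 = int (8 * n + 3)}"
    proof
      fix t assume "t \<in> ?S"
      moreover obtain x k where t: "t = (x, k)" by (cases t)
      ultimately have xk: "(x, k) \<in> ?S" by (simp only: t)
      show "(\<lambda>(x, k). (2 * x, 2 * k + 1)) t \<in> {(x, y). 2 * x\<^sup>2 + 3 * y\<^sup>2 = int (8 * n + 3)}"
        using xk unfolding S_iff by (simp only: t prod.case mem_Collect_eq)
    qed
    show "(\<lambda>(x, y). (x div 2, (y - 1) div 2)) \<in> {(x, y). 2 * x\<^sup>2 + 3 * y\<^sup>2 = int (8 * n + 3)} \<rightarrow> ?S"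
    proof
      fix t assume "t \<in> {(x, y). 2 * x\<^sup>2 + 3 * y\<^sup>2 = int (8 * n + 3)}"
      then obtain x y where t: "t = (x, y)" and xy: "2 * x\<^sup>2 + 3 * y\<^sup>2 = int (8 * n + 3)" by auto
      from parity[OF xy] have "2 * (x div 2) = x" "2 * ((y - 1) div 2) + 1 = y" by presburger+
      then show "(\<lambda>(x, y). (x div 2, (y - 1) div 2)) t \<in> ?S"
        unfolding t prod.case S_iff using xy by simp
    qed
    fix t assume "t \<in> {(x, y). 2 * x\<^sup>2 + 3 * y\<^sup>2 = int (8 * n + 3)}"
    then obtain x y where t: "t = (x, y)" and xy: "2 * x\<^sup>2 + 3 * y\<^sup>2 = int (8 * n + 3)" by auto
    from parity[OF xy] show "(\<lambda>(x, k). (2 * x, 2 * k + 1)) ((\<lambda>(x, y). (x div 2, (y - 1) div 2)) t) = t"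
      unfolding t by simp
  qed auto
  then have card: "card ?S = num_reps (8 * n + 3) (\<lambda>x y. 2 * x\<^sup>2 + 3 * y\<^sup>2)"
    unfolding num_reps_def by (rule bij_betw_same_card)
  have "(of_int (int (ped (3 * n + 1))) :: 3) = (-1) ^ (n + 1) * (section3 1 (Abs_fps (\<lambda>n. (-1) ^ n * of_nat (ped n))) $ n)"
    by (simp add: section3_def power_mult flip: power_add mult.assoc power_mult_distrib)
  also have "\<dots> = (-1) ^ (n + 1) * (\<Sum>(x, k)\<in>?S. 1 * 1)"
    unfolding section3_ped[OF three] phi_def psi_def
    by (subst gf_mult[OF finite_fibres_square finite_fibres_tri]) (simp_all add: gf_nth)
  also have "\<dots> = of_int ((-1) ^ (n + 1) * int (num_reps (8 * n + 3) (\<lambda>x y. 2 * x\<^sup>2 + 3 * y\<^sup>2)))"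
    unfolding card[symmetric] by (simp add: case_prod_unfold)
  finally show "(of_int (int (ped (3 * n + 1))) :: 3) = \<dots>" .
qed

text \<open>Since 48 n + 18 = 3 * 2 * (8 n + 3), doubling x carries the representations of 8 n + 3
  by the second form to those of 16 n + 6 by the first.\<close>

lemma ped_overp_odd_cong: "[(-1) ^ n * int (ped (3 * n + 1)) = int (overp_odd (48 * n + 18))] (mod 3)"
proof -
  let ?N = "16 * n + 6"
  let ?R = "num_reps (8 * n + 3) (\<lambda>x y. 2 * x\<^sup>2 + 3 * y\<^sup>2)"
  have iff: "2 * x\<^sup>2 + 3 * y\<^sup>2 = int (8 * n + 3) \<longleftrightarrow> (2 * x)\<^sup>2 + 6 * y\<^sup>2 = int ?N" for x y
    by (auto simp: power2_eq_square)
  have even: "even x" if "x\<^sup>2 + 6 * y\<^sup>2 = int ?N" for x y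
  proof -
    have "even (x\<^sup>2 + 6 * y\<^sup>2)" unfolding that by simp
    then show ?thesis by simp
  qed
  have R: "?R = num_reps ?N (\<lambda>x y. x\<^sup>2 + 6 * y\<^sup>2)"
    unfolding num_reps_def
  proof (rule bij_betw_same_card[OF bij_betwI[where g = "\<lambda>(x, y). (x div 2, y)"]])
    show "(\<lambda>(x, y). (2 * x, y)) \<in> {(x, y). 2 * x\<^sup>2 + 3 * y\<^sup>2 = int (8 * n + 3)} \<rightarrow> {(x, y). x\<^sup>2 + 6 * y\<^sup>2 = int ?N}"
    proof
      fix t assume "t \<in> {(x, y). 2 * x\<^sup>2 + 3 * y\<^sup>2 = int (8 * n + 3)}"
      then obtain x y where t: "t = (x, y)" and xy: "2 * x\<^sup>2 + 3 * y\<^sup>2 = int (8 * n + 3)" by auto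
      show "(\<lambda>(x, y). (2 * x, y)) t \<in> {(x, y). x\<^sup>2 + 6 * y\<^sup>2 = int ?N}"
        using xy unfolding iff by (simp only: t prod.case mem_Collect_eq)
    qed
    show "(\<lambda>(x, y). (x div 2, y)) \<in> {(x, y). x\<^sup>2 + 6 * y\<^sup>2 = int ?N} \<rightarrow> {(x, y). 2 * x\<^sup>2 + 3 * y\<^sup>2 = int (8 * n + 3)}"
    proof
      fix t assume "t \<in> {(x, y). x\<^sup>2 + 6 * y\<^sup>2 = int ?N}"
      then obtain x y where t: "t = (x, y)" and xy: "x\<^sup>2 + 6 * y\<^sup>2 = int ?N" by auto
      have "2 * (x div 2) = x" using even[OF xy] by simp
      then show "(\<lambda>(x, y). (x div 2, y)) t \<in> {(x, y). 2 * x\<^sup>2 + 3 * y\<^sup>2 = int (8 * n + 3)}"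
        using xy unfolding t prod.case mem_Collect_eq iff by simp
    qed
  qed (use even in auto)
  \<comment> \<open>Modulo 12 the number is 2, 6 or 10. The sign is -1 for the last two, and x^2 + 6
    y^2 never takes the residue 2.\<close>
  have "num_reps ?N (\<lambda>x y. x\<^sup>2 + 6 * y\<^sup>2) = 0 \<or> f_sign ?N = -1"
  proof (rule disjCI)
    assume "f_sign ?N \<noteq> -1"
    then have "?N mod 12 \<notin> {6, 10}" by (auto simp: f_sign_def split: if_splits)
    moreover have "?N mod 12 = 2 \<or> ?N mod 12 = 6 \<or> ?N mod 12 = 10" by presburger
    ultimately have "int (?N mod 12) = 2" by auto
    then have "int ?N mod 12 = 2" by (simp only: zmod_int of_nat_numeral)
    have "x\<^sup>2 + 6 * y\<^sup>2 \<noteq> int ?N" for x y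
    proof
      assume "x\<^sup>2 + 6 * y\<^sup>2 = int ?N"
      then have "(x\<^sup>2 mod 12 + 6 * (y\<^sup>2 mod 12)) mod 12 = 2"
        using \<open>int ?N mod 12 = 2\<close> by (simp only: form_mod_12[symmetric])
      then show False unfolding square_mod_12 by (auto split: if_splits)
    qed
    then have "{(x, y). x\<^sup>2 + 6 * y\<^sup>2 = int ?N} = {}" by blast
    then show "num_reps ?N (\<lambda>x y. x\<^sup>2 + 6 * y\<^sup>2) = 0" unfolding num_reps_def by simp
  qed
  then have "f_sign ?N * int (num_reps ?N (\<lambda>x y. x\<^sup>2 + 6 * y\<^sup>2)) = - int ?R"
    unfolding R by auto
  moreover have "3 * ?N = 48 * n + 18" by simp
  ultimately have overp: "[int (overp_odd (48 * n + 18)) = - int ?R] (mod 3)"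
    using overp_odd_cong[of ?N] by simp
  have "[(-1) ^ n * int (ped (3 * n + 1)) = (-1) ^ n * ((-1) ^ (n + 1) * int ?R)] (mod 3)"
    by (rule cong_mult[OF cong_refl ped_cong])
  also have "(-1) ^ n * ((-1) ^ (n + 1) * int ?R) = - int ?R"
    by (simp flip: mult.assoc power_mult_distrib)
  finally show ?thesis
    using overp by (meson cong_sym cong_trans)
qed

section \<open>Representations by the forms of discriminant -24\<close>

text \<open>The flag is the class in the form class group of order 2, with \<open>False\<close> the
  principal class; composing the classes \<open>b\<close> and \<open>d\<close> gives
  \<open>b \<noteq> d\<close>.\<close>

definition form :: "bool \<Rightarrow> int \<Rightarrow> int \<Rightarrow> int" where
  "form b x y = (if b then 2 * x\<^sup>2 + 3 * y\<^sup>2 else x\<^sup>2 + 6 * y\<^sup>2)"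

definition reps :: "bool \<Rightarrow> nat \<Rightarrow> (int \<times> int) set" where
  "reps b n = {(x, y). form b x y = int n}"

definition rep_count :: "bool \<Rightarrow> nat \<Rightarrow> nat" where
  "rep_count b n = card (reps b n)"

lemma finite_reps: "finite (reps b n)"
proof (rule finite_subset)
  show "reps b n \<subseteq> {-int n..int n} \<times> {-int n..int n}"
  proof
    fix t assume "t \<in> reps b n"
    then obtain x y where t: "t = (x, y)" and xy: "form b x y = int n"
      by (auto simp: reps_def)
    have "x\<^sup>2 \<le> int n" "y\<^sup>2 \<le> int n"
      using xy unfolding form_def
      by (cases b; simp; insert zero_le_power2[of x] zero_le_power2[of y]; linarith)+
    then show "t \<in> {-int n..int n} \<times> {-int n..int n}"
      using abs_le_square[of x] abs_le_square[of y] by (auto simp: t abs_le_iff)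
  qed
qed simp

text \<open>
  Multiplication by \<open>u \<plusminus> v \<surd>-6\<close>: every representation of \<open>p n\<close> lies in the image of one of the two
  signs, and it lies in both images iff it is divisible by \<open>p\<close>.
\<close>

lemma card_composition:
  fixes p A C a c e f \<alpha> \<beta> \<gamma> \<delta> u v n :: int
  assumes p: "prime p" "p = A * u\<^sup>2 + C * v\<^sup>2"
    and ndvd: "\<not> p dvd 2" "\<not> p dvd \<alpha>" "\<not> p dvd \<delta>" "\<not> p dvd f" "\<not> p dvd A" "\<not> p dvd C"
    and eqs: "\<alpha> * \<gamma> = A" "\<beta> * \<delta> = C" "e * \<alpha>\<^sup>2 = A * a" "e * \<beta>\<^sup>2 = C * c" "f * \<gamma>\<^sup>2 = A * c" "f * \<delta>\<^sup>2 = C * a"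
      "e * \<alpha> * \<beta> = f * \<gamma> * \<delta>"
    and fin: "finite {(x, y). e * x\<^sup>2 + f * y\<^sup>2 = p * n}"
  shows "card {(x, y). e * x\<^sup>2 + f * y\<^sup>2 = p * n} + card {(x, y). p * (e * x\<^sup>2 + f * y\<^sup>2) = n} =
    2 * card {(x, y). a * x\<^sup>2 + c * y\<^sup>2 = n}"
proof -
  define T where "T = {(x, y). e * x\<^sup>2 + f * y\<^sup>2 = p * n}"
  define S where "S = {(x, y). a * x\<^sup>2 + c * y\<^sup>2 = n}"
  define U where "U = {(x, y). p * (e * x\<^sup>2 + f * y\<^sup>2) = n}"
  \<comment> \<open>These are the pairs whose preimage under composition with (u, v) has an integral
    second coordinate; \<open>P (- v)\<close> belongs to the conjugate.\<close>
  define P where "P v = {(X, Y) \<in> T. p dvd \<alpha> * u * Y - \<delta> * v * X}" for v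
  have p0: "p \<noteq> 0" using p(1) by auto
  have dvd_mult: "p dvd x * y \<longleftrightarrow> p dvd x \<or> p dvd y" for x y
    using p(1) by (rule prime_dvd_mult_iff)
  \<comment> \<open>If p divided one of u and v it would divide both, and then p^2 would divide
    p.\<close>
  have "\<not> p dvd u \<and> \<not> p dvd v"
  proof (rule ccontr)
    assume "\<not> (\<not> p dvd u \<and> \<not> p dvd v)"
    moreover have "A * u * u + C * v * v = p * 1"
      using p(2) by (simp add: power2_eq_square)
    then have "p dvd A * u * u \<longleftrightarrow> p dvd C * v * v"
      by (metis dvd_add_left_iff dvd_add_right_iff dvd_triv_left)
    then have "p dvd u \<longleftrightarrow> p dvd v"
      using ndvd(5,6) unfolding dvd_mult by blast
    ultimately have "p dvd u" "p dvd v" by blast+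
    then obtain r s where "u = p * r" "v = p * s" by (elim dvdE)
    have "p * 1 = A * u\<^sup>2 + C * v\<^sup>2"
      unfolding mult_1_right by (rule p(2))
    also have "\<dots> = p * (p * (A * r\<^sup>2 + C * s\<^sup>2))"
      unfolding \<open>u = p * r\<close> \<open>v = p * s\<close> by (simp add: power2_eq_square algebra_simps)
    finally have "p * 1 = p * (p * (A * r\<^sup>2 + C * s\<^sup>2))" .
    then have "1 = p * (A * r\<^sup>2 + C * s\<^sup>2)" using p0 by (simp only: mult_cancel_left) simp
    then have "p dvd 1" by (rule dvdI)
    then show False using p(1) not_prime_unit by blast
  qed
  then have uv: "\<not> p dvd u" "\<not> p dvd v" by auto
  have card_P: "card (P v) = card S" if v: "p = A * u\<^sup>2 + C * v\<^sup>2" "\<not> p dvd v" for v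
  proof -
    \<comment> \<open>Composition is a linear map of determinant A u^2 + C v^2 = p, and
      \<open>m'\<close> is its adjugate divided by p.\<close>
    define m where "m = (\<lambda>(x, y). (\<alpha> * u * x - \<beta> * v * y, \<gamma> * u * y + \<delta> * v * x))"
    define m' where "m' = (\<lambda>(X, Y). ((\<gamma> * u * X + \<beta> * v * Y) div p, (\<alpha> * u * Y - \<delta> * v * X) div p))"
    have inv: "\<gamma> * u * (\<alpha> * u * x - \<beta> * v * y) + \<beta> * v * (\<gamma> * u * y + \<delta> * v * x) = p * x"
      "\<alpha> * u * (\<gamma> * u * y + \<delta> * v * x) - \<delta> * v * (\<alpha> * u * x - \<beta> * v * y) = p * y" for x y
      unfolding v(1) eqs(1,2)[symmetric] by (simp_all add: power2_eq_square algebra_simps)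
    have norm: "e * (\<alpha> * u * x - \<beta> * v * y)\<^sup>2 + f * (\<gamma> * u * y + \<delta> * v * x)\<^sup>2 = p * (a * x\<^sup>2 + c * y\<^sup>2)" for x y
    proof -
      have "e * (\<alpha> * u * x - \<beta> * v * y)\<^sup>2 + f * (\<gamma> * u * y + \<delta> * v * x)\<^sup>2 =
          (e * \<alpha>\<^sup>2) * (u * x)\<^sup>2 + (e * \<beta>\<^sup>2) * (v * y)\<^sup>2 + (f * \<gamma>\<^sup>2) * (u * y)\<^sup>2 + (f * \<delta>\<^sup>2) * (v * x)\<^sup>2
          + 2 * (f * \<gamma> * \<delta> - e * \<alpha> * \<beta>) * (u * x * v * y)"
        by (simp add: power2_eq_square algebra_simps)
      also have "\<dots> = (A * u\<^sup>2 + C * v\<^sup>2) * (a * x\<^sup>2 + c * y\<^sup>2)"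
        unfolding eqs(3-7) by (simp add: power2_eq_square algebra_simps)
      finally show ?thesis unfolding v(1) .
    qed
    have "bij_betw m S (P v)"
    proof (rule bij_betwI[where g = m'])
      show "m \<in> S \<rightarrow> P v"
        by (auto simp: S_def P_def T_def m_def norm inv)
      show "m' (m t) = t" if "t \<in> S" for t
        by (cases t) (simp add: m_def m'_def inv p0)
      have m': "m (m' t) = t \<and> m' t \<in> S" if t: "t \<in> P v" for t
      proof -
        obtain X Y where XY: "t = (X, Y)" by (cases t)
        have T: "e * X\<^sup>2 + f * Y\<^sup>2 = p * n" and "p dvd \<alpha> * u * Y - \<delta> * v * X"
          using t by (auto simp: P_def T_def XY)
        then obtain y where y: "\<alpha> * u * Y - \<delta> * v * X = p * y" by (elim dvdE)
        \<comment> \<open>Integrality of the second coordinate forces that of the first, because p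
          divides neither \<delta> nor v.\<close>
        have "\<delta> * v * (\<gamma> * u * X + \<beta> * v * Y) = p * Y - \<gamma> * u * (\<alpha> * u * Y - \<delta> * v * X)"
          unfolding v(1) eqs(1,2)[symmetric] by (simp add: power2_eq_square algebra_simps)
        also have "\<dots> = p * (Y - \<gamma> * u * y)"
          unfolding y by (simp add: algebra_simps)
        finally have "p dvd \<delta> * v * (\<gamma> * u * X + \<beta> * v * Y)" by simp
        then have "p dvd \<gamma> * u * X + \<beta> * v * Y"
          using v(2) ndvd(3) by (simp add: dvd_mult)
        then obtain x where x: "\<gamma> * u * X + \<beta> * v * Y = p * x" by (elim dvdE)
        have m't: "m' t = (x, y)" by (simp add: m'_def XY x y p0)
        have "p * (\<alpha> * u * x - \<beta> * v * y) = \<alpha> * u * (\<gamma> * u * X + \<beta> * v * Y) - \<beta> * v * (\<alpha> * u * Y - \<delta> * v * X)"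
          unfolding x y by (simp add: algebra_simps)
        also have "\<dots> = p * X"
          unfolding v(1) eqs(1,2)[symmetric] by (simp add: power2_eq_square algebra_simps)
        finally have X: "\<alpha> * u * x - \<beta> * v * y = X" using p0 by simp
        have "p * (\<gamma> * u * y + \<delta> * v * x) = \<gamma> * u * (\<alpha> * u * Y - \<delta> * v * X) + \<delta> * v * (\<gamma> * u * X + \<beta> * v * Y)"
          unfolding x y by (simp add: algebra_simps)
        also have "\<dots> = p * Y"
          unfolding v(1) eqs(1,2)[symmetric] by (simp add: power2_eq_square algebra_simps)
        finally have Y: "\<gamma> * u * y + \<delta> * v * x = Y" using p0 by simp
        have "p * (a * x\<^sup>2 + c * y\<^sup>2) = p * n"
          using norm[of x y] T unfolding X Y by metis
        then show ?thesis unfolding m't using X Y p0 by (simp add: m_def XY S_def)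
      qed
      show "m' \<in> P v \<rightarrow> S" using m' by blast
      show "m (m' t) = t" if "t \<in> P v" for t using m'[OF that] by blast
    qed
    then show ?thesis by (metis bij_betw_same_card)
  qed
  have "T = P v \<union> P (- v)"
  proof
    show "T \<subseteq> P v \<union> P (- v)"
    proof
      fix t assume t: "t \<in> T"
      obtain X Y where XY: "t = (X, Y)" by (cases t)
      have T: "e * X\<^sup>2 + f * Y\<^sup>2 = p * n" using t by (simp add: XY T_def)
      \<comment> \<open>Up to the unit f modulo p, the product of the conditions for v and -v is a
        multiple of p, so one of them holds because p is prime.\<close>
      have "f * ((\<alpha> * u * Y - \<delta> * v * X) * (\<alpha> * u * Y + \<delta> * v * X)) =
          \<alpha>\<^sup>2 * u\<^sup>2 * (e * X\<^sup>2 + f * Y\<^sup>2) - (e * \<alpha>\<^sup>2) * u\<^sup>2 * X\<^sup>2 - (f * \<delta>\<^sup>2) * v\<^sup>2 * X\<^sup>2"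
        by (simp add: power2_eq_square algebra_simps)
      also have "\<dots> = p * (\<alpha>\<^sup>2 * u\<^sup>2 * n) - (A * u\<^sup>2 + C * v\<^sup>2) * (a * X\<^sup>2)"
        unfolding T eqs by (simp add: algebra_simps)
      also have "\<dots> = p * (\<alpha>\<^sup>2 * u\<^sup>2 * n - a * X\<^sup>2)"
        unfolding p(2)[symmetric] by (simp add: algebra_simps)
      finally have "p dvd f * ((\<alpha> * u * Y - \<delta> * v * X) * (\<alpha> * u * Y + \<delta> * v * X))" by simp
      then have "p dvd \<alpha> * u * Y - \<delta> * v * X \<or> p dvd \<alpha> * u * Y + \<delta> * v * X"
        using ndvd(4) unfolding dvd_mult by blast
      then show "t \<in> P v \<union> P (- v)" using t by (auto simp: XY P_def)
    qed
  qed (auto simp: P_def)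
  moreover have finT: "finite T" using fin by (simp add: T_def)
  then have "finite (P v)" "finite (P (- v))" by (auto simp: P_def elim: rev_finite_subset)
  ultimately have "card T + card (P v \<inter> P (- v)) = card (P v) + card (P (- v))"
    using card_Un_Int[of "P v" "P (- v)"] by simp
  moreover have "card (P v) = card S" "card (P (- v)) = card S"
    using p(2) uv by (intro card_P; simp)+
  moreover have "card U = card (P v \<inter> P (- v))"
  proof (rule bij_betw_same_card[OF bij_betwI[where f = "\<lambda>(x, y). (p * x, p * y)" and g = "\<lambda>(x, y). (x div p, y div p)"]])
    show "(\<lambda>(x, y). (p * x, p * y)) \<in> U \<rightarrow> P v \<inter> P (- v)"
      by (auto simp: U_def P_def T_def power2_eq_square algebra_simps)
    have both: "\<exists>r s. t = (p * r, p * s) \<and> (r, s) \<in> U" if t: "t \<in> P v \<inter> P (- v)" for t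
    proof -
      obtain X Y where XY: "t = (X, Y)" by (cases t)
      have T: "e * X\<^sup>2 + f * Y\<^sup>2 = p * n" and d: "p dvd \<alpha> * u * Y - \<delta> * v * X" "p dvd \<alpha> * u * Y + \<delta> * v * X"
        using t by (auto simp: P_def T_def XY)
      have "p dvd 2 * (\<alpha> * u * Y)" "p dvd 2 * (\<delta> * v * X)"
        using dvd_add[OF d] dvd_diff[OF d(2,1)] by (simp_all add: algebra_simps)
      then have "p dvd Y" "p dvd X" using uv ndvd unfolding dvd_mult by blast+
      then obtain r s where rs: "X = p * r" "Y = p * s" by (elim dvdE)
      then have "p * (p * (e * r\<^sup>2 + f * s\<^sup>2)) = p * n" using T by (simp add: power2_eq_square algebra_simps)
      then have "(r, s) \<in> U" using p0 by (simp add: U_def)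
      then show ?thesis using rs XY by blast
    qed
    show "(\<lambda>(x, y). (x div p, y div p)) \<in> P v \<inter> P (- v) \<rightarrow> U"
      using both p0 by fastforce
    show "(\<lambda>(x, y). (p * x, p * y)) ((\<lambda>(x, y). (x div p, y div p)) t) = t" if "t \<in> P v \<inter> P (- v)" for t
      using both[OF that] p0 by auto
  qed (use p0 in auto)
  ultimately show ?thesis by (simp add: T_def S_def U_def)
qed

text \<open>The Hecke recurrence at p: the second summand is the count for n / p if p divides n, and
  0 otherwise. The bound \<open>p > 3\<close> keeps p away from all coefficients of the
  forms.\<close>

lemma rep_count_split:
  assumes p: "prime p" "p > 3" and uv: "form b u v = int p"
  shows "rep_count (b \<noteq> d) (p * n) + card {(x, y). int p * form (b \<noteq> d) x y = int n} = 2 * rep_count d n"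
proof -
  have prime: "prime (int p)" using p by simp
  have ndvd: "\<not> int p dvd 2" "\<not> int p dvd 1" "\<not> int p dvd 3" using p(2) by (auto dest: zdvd_imp_le)
  have "\<not> int p dvd 6"
  proof
    assume "int p dvd 6"
    then have "int p dvd 2 * 3" by simp
    then show False using ndvd prime_dvd_mult_iff[OF prime] by blast
  qed
  note ndvd = ndvd this
  have fin: "finite {(x, y). form (b \<noteq> d) x y = int p * int n}"
    using finite_reps[of "b \<noteq> d" "p * n"] by (simp add: reps_def)
  show ?thesis
  \<comment> \<open>Each case is a classical product formula, such as (2 u^2 + 3 v^2) (2 x^2 + 3
    y^2) = (2 u x - 3 v y)^2 + 6 (u y + v x)^2 in the first one.\<close>
  proof (cases b; cases d)
    assume [simp]: "b" "d"
    have "card {(x, y). 1 * x\<^sup>2 + 6 * y\<^sup>2 = int p * int n} + card {(x, y). int p * (1 * x\<^sup>2 + 6 * y\<^sup>2) = int n} =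
        2 * card {(x, y). 2 * x\<^sup>2 + 3 * y\<^sup>2 = int n}"
      by (rule card_composition[where A = 2 and C = 3 and u = u and v = v
            and \<alpha> = 2 and \<beta> = 3 and \<gamma> = 1 and \<delta> = 1]) (use prime uv ndvd fin in \<open>simp_all add: form_def\<close>)
    then show ?thesis
      by (simp add: form_def rep_count_def reps_def)
  next
    assume [simp]: "b" "\<not> d"
    have "card {(x, y). 2 * x\<^sup>2 + 3 * y\<^sup>2 = int p * int n} + card {(x, y). int p * (2 * x\<^sup>2 + 3 * y\<^sup>2) = int n} =
        2 * card {(x, y). 1 * x\<^sup>2 + 6 * y\<^sup>2 = int n}"
      by (rule card_composition[where A = 2 and C = 3 and u = u and v = v
            and \<alpha> = 1 and \<beta> = 3 and \<gamma> = 2 and \<delta> = 1]) (use prime uv ndvd fin in \<open>simp_all add: form_def\<close>)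
    then show ?thesis
      by (simp add: form_def rep_count_def reps_def)
  next
    assume [simp]: "\<not> b" "d"
    have "card {(x, y). 2 * x\<^sup>2 + 3 * y\<^sup>2 = int p * int n} + card {(x, y). int p * (2 * x\<^sup>2 + 3 * y\<^sup>2) = int n} =
        2 * card {(x, y). 2 * x\<^sup>2 + 3 * y\<^sup>2 = int n}"
      by (rule card_composition[where A = 1 and C = 6 and u = u and v = v
            and \<alpha> = 1 and \<beta> = 3 and \<gamma> = 1 and \<delta> = 2]) (use prime uv ndvd fin in \<open>simp_all add: form_def\<close>)
    then show ?thesis
      by (simp add: form_def rep_count_def reps_def)
  next
    assume [simp]: "\<not> b" "\<not> d"
    have "card {(x, y). 1 * x\<^sup>2 + 6 * y\<^sup>2 = int p * int n} + card {(x, y). int p * (1 * x\<^sup>2 + 6 * y\<^sup>2) = int n} =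
        2 * card {(x, y). 1 * x\<^sup>2 + 6 * y\<^sup>2 = int n}"
      by (rule card_composition[where A = 1 and C = 6 and u = u and v = v
            and \<alpha> = 1 and \<beta> = 6 and \<gamma> = 1 and \<delta> = 1]) (use prime uv ndvd fin in \<open>simp_all add: form_def\<close>)
    then show ?thesis
      by (simp add: form_def rep_count_def reps_def)
  qed
qed

text \<open>The recurrence makes the counts along powers of p an arithmetic progression, 2 (k + 2) -
  (k + 1) = k + 3, while the class changes at every step if \<open>b\<close> holds.\<close>

lemma rep_count_split_power:
  assumes p: "prime p" "p > 3" and uv: "form b u v = int p" and m: "\<not> p dvd m"
  shows "rep_count d (p ^ k * m) = (k + 1) * rep_count (d \<noteq> (b \<and> odd k)) m"
proof (induction k arbitrary: d rule: induct_nat_012)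
  case 0 show ?case by simp
next
  case 1
  have "int p * x \<noteq> int m" for x
    using m by (metis dvd_triv_left int_dvd_int_iff)
  then have "{(x, y). int p * form (b \<noteq> (b \<noteq> d)) x y = int m} = {}" by auto
  then show ?case
    using rep_count_split[OF p uv, of "b \<noteq> d" m] by (cases b; cases d) auto
next
  case (ge2 k)
  have "{(x, y). int p * form (b \<noteq> (b \<noteq> d)) x y = int (p ^ Suc k * m)} = reps (b \<noteq> (b \<noteq> d)) (p ^ k * m)"
    using p by (auto simp: reps_def)
  then have "rep_count d (p ^ Suc (Suc k) * m) + rep_count d (p ^ k * m) = 2 * rep_count (b \<noteq> d) (p ^ Suc k * m)"
    using rep_count_split[OF p uv, of "b \<noteq> d" "p ^ Suc k * m"] by (cases b; cases d) (auto simp: rep_count_def mult_ac)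
  then show ?case
    using ge2.IH(1)[of d] ge2.IH(2)[of "b \<noteq> d"] by (cases b; cases "odd k"; cases d) auto
qed

section \<open>The ramified primes 2 and 3, and the base case 1\<close>

lemma rep_count_eqI:
  assumes "inj m" and "\<And>x y. form b x y = int N \<longleftrightarrow> (\<exists>x' y'. (x, y) = m (x', y') \<and> form b' x' y' = int n)"
  shows "rep_count b N = rep_count b' n"
proof -
  have "reps b N = m ` reps b' n"
    using assms(2) by (auto simp: reps_def image_iff)
  then show ?thesis
    unfolding rep_count_def using assms(1) by (simp add: card_image inj_on_subset)
qed

text \<open>The prime 2 divides the discriminant: a value divisible by 2 forces one coordinate to be
  even, and dividing the form by 2 then gives the other class, so no representation is gained or
  lost.\<close>

lemma rep_count_double: "rep_count d (2 * n) = rep_count (\<not> d) n"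
proof (cases d)
  case True
  have "\<exists>z. y = 2 * z" if "2 * x\<^sup>2 + 3 * y\<^sup>2 = 2 * int n" for x y
  proof -
    have "even (2 * x\<^sup>2 + 3 * y\<^sup>2)" unfolding that by simp
    then show ?thesis by (auto elim: evenE)
  qed
  then have "rep_count True (2 * n) = rep_count False n"
    by (intro rep_count_eqI[where m = "\<lambda>(x, y). (x, 2 * y)"])
      (auto simp: inj_def form_def power2_eq_square, force)
  then show ?thesis using True by simp
next
  case False
  have "\<exists>z. x = 2 * z" if "x\<^sup>2 + 6 * y\<^sup>2 = 2 * int n" for x y
  proof -
    have "even (x\<^sup>2 + 6 * y\<^sup>2)" unfolding that by simp
    then show ?thesis by (auto elim: evenE)
  qed
  then have "rep_count False (2 * n) = rep_count True n"
    by (intro rep_count_eqI[where m = "\<lambda>(x, y). (2 * x, y)"])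
      (auto simp: inj_def form_def power2_eq_square, force)
  then show ?thesis using False by simp
qed

lemma rep_count_triple: "rep_count d (3 * n) = rep_count (\<not> d) n"
proof (cases d)
  case True
  have "\<exists>z. x = 3 * z" if "2 * x\<^sup>2 + 3 * y\<^sup>2 = 3 * int n" for x y
  proof -
    have "2 * x\<^sup>2 = 3 * (int n - y\<^sup>2)" using that by simp
    then have "3 dvd 2 * x\<^sup>2" by (rule dvdI)
    moreover have "3 dvd a" if "3 dvd 2 * a" for a :: int using that by presburger
    ultimately have "3 dvd x\<^sup>2" by blast
    then have "3 dvd x" by (rule prime_dvd_power[rotated]) simp
    then show ?thesis by (auto elim: dvdE)
  qed
  then have "rep_count True (3 * n) = rep_count False n"
    by (intro rep_count_eqI[where m = "\<lambda>(x, y). (3 * y, x)"])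
      (auto simp: inj_def form_def power2_eq_square, force)
  then show ?thesis using True by simp
next
  case False
  have "\<exists>z. x = 3 * z" if "x\<^sup>2 + 6 * y\<^sup>2 = 3 * int n" for x y
  proof -
    have "x\<^sup>2 = 3 * (int n - 2 * y\<^sup>2)" using that by simp
    then have "3 dvd x\<^sup>2" by (rule dvdI)
    then have "3 dvd x" by (rule prime_dvd_power[rotated]) simp
    then show ?thesis by (auto elim: dvdE)
  qed
  then have "rep_count False (3 * n) = rep_count True n"
    by (intro rep_count_eqI[where m = "\<lambda>(x, y). (3 * y, x)"])
      (auto simp: inj_def form_def power2_eq_square, force)
  then show ?thesis using False by simp
qed

lemma rep_count_one: "rep_count d 1 = (if d then 0 else 2)"
proof (cases d)
  case True
  have "2 * x\<^sup>2 + 3 * y\<^sup>2 \<noteq> 1" for x y :: int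
  proof -
    have "2 * a + 3 * b \<noteq> 1" if "0 \<le> a" "0 \<le> b" for a b :: int
      using that by presburger
    then show ?thesis by simp
  qed
  then show ?thesis using True by (simp add: rep_count_def reps_def form_def)
next
  case False
  have "x\<^sup>2 + 6 * y\<^sup>2 = 1 \<longleftrightarrow> x = 1 \<and> y = 0 \<or> x = -1 \<and> y = 0" for x y :: int
  proof
    assume *: "x\<^sup>2 + 6 * y\<^sup>2 = 1"
    have "b = 0" if "a + 6 * b = 1" "0 \<le> a" "0 \<le> b" for a b :: int
      using that by presburger
    from this[OF *] have "y\<^sup>2 = 0" by simp
    then show "x = 1 \<and> y = 0 \<or> x = -1 \<and> y = 0" using * by (simp add: power2_eq_1_iff)
  qed auto
  then have "reps False 1 = {(1, 0), (-1, 0)}" by (auto simp: reps_def form_def)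
  then show ?thesis using False by (simp add: rep_count_def)
qed

section \<open>Primes represented by one of the two forms\<close>

lemma thue:
  fixes p :: nat and t :: int
  assumes "p > 0"
  obtains x y :: int where "(x, y) \<noteq> (0, 0)" "int p dvd x - t * y" "x\<^sup>2 \<le> int p" "y\<^sup>2 \<le> int p"
proof -
  define s where "s = floor_sqrt p"
  let ?D = "{0..int s} \<times> {0..int s}"
  let ?f = "\<lambda>(x, y). (x - t * y) mod int p"
  have "?f ` ?D \<subseteq> {0..<int p}" using assms by auto
  then have "card (?f ` ?D) \<le> p" using card_mono[of "{0..<int p}" "?f ` ?D"] by simp
  \<comment> \<open>There are more pairs in the square than residues, so two pairs collide; their
    difference is the required vector.\<close>
  also have "p < (s + 1)\<^sup>2"
    unfolding s_def using Suc_floor_sqrt_power2_gt[of p] by simp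
  also have "(s + 1)\<^sup>2 = card ?D"
    by (simp add: power2_eq_square nat_add_distrib)
  finally have "\<not> inj_on ?f ?D" using pigeonhole by blast
  then obtain a b where ab: "a \<in> ?D" "b \<in> ?D" "a \<noteq> b" "?f a = ?f b"
    by (auto simp: inj_on_def)
  obtain x y x' y' where xy: "a = (x, y)" "b = (x', y')" by (metis surj_pair)
  have sq: "(x - x')\<^sup>2 \<le> int p" if "x \<in> {0..int s}" "x' \<in> {0..int s}" for x x'
  proof -
    have "\<bar>x - x'\<bar> \<le> \<bar>int s\<bar>" using that by auto
    then have "(x - x')\<^sup>2 \<le> (int s)\<^sup>2" by (simp only: abs_le_square_iff)
    also have "\<dots> = int (s\<^sup>2)" by simp
    also have "\<dots> \<le> int p" unfolding s_def of_nat_le_iff by (rule floor_sqrt_power2_le)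
    finally show ?thesis .
  qed
  have "(x - t * y) mod int p = (x' - t * y') mod int p" using ab(4) by (simp add: xy)
  then have "int p dvd (x - t * y) - (x' - t * y')" by (simp add: mod_eq_dvd_iff)
  then have "int p dvd (x - x') - t * (y - y')" by (simp add: algebra_simps)
  moreover have "(x - x', y - y') \<noteq> (0, 0)" using ab(3) by (auto simp: xy)
  ultimately show ?thesis
    using that sq ab(1,2) unfolding xy by (metis mem_Sigma_iff)
qed

text \<open>Thue's vector satisfies x^2 + 6 y^2 = k p with 0 < k < 7. For each k except 5,
  divisibility of the coordinates lets the factor k be removed directly.\<close>

lemma prime_form_exists:
  assumes p: "prime p" "p > 3" and t: "int p dvd t\<^sup>2 + 6"
  shows "\<exists>b u v. form b u v = int p"
proof -
  obtain x y where xy: "(x, y) \<noteq> (0, 0)" "int p dvd x - t * y" "x\<^sup>2 \<le> int p" "y\<^sup>2 \<le> int p"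
    using thue[of p t] p by (metis less_trans zero_less_numeral)
  have "x\<^sup>2 + 6 * y\<^sup>2 = (x - t * y) * (x + t * y) + (t\<^sup>2 + 6) * y\<^sup>2"
    by (simp add: power2_eq_square algebra_simps)
  then have "int p dvd x\<^sup>2 + 6 * y\<^sup>2" using xy(2) t by simp
  then obtain k where k: "x\<^sup>2 + 6 * y\<^sup>2 = int p * k" by (elim dvdE)
  \<comment> \<open>A prime is not a square, so the bounds of Thue's lemma are strict and k = 7 is
    excluded.\<close>
  have not_square: "z\<^sup>2 \<noteq> int p" for z
  proof
    assume "z\<^sup>2 = int p"
    then have "(nat \<bar>z\<bar>)\<^sup>2 = p" by (metis abs_ge_zero nat_int nat_power_eq power2_abs)
    then show False using p(1) prime_power_iff[of "nat \<bar>z\<bar>" 2] by auto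
  qed
  have pos: "x\<^sup>2 + 6 * y\<^sup>2 > 0"
    using xy(1) zero_le_power2[of x] zero_le_power2[of y] by (auto simp: less_le add_nonneg_eq_0_iff)
  have "x\<^sup>2 < int p" "y\<^sup>2 < int p" using xy(3,4) not_square by (auto simp: less_le)
  then have "int p * k < int p * 7" using k by linarith
  moreover have "int p * 0 < int p * k" using pos k by simp
  ultimately have "k < 7" "0 < k" by (simp_all only: mult_less_cancel_left_pos p of_nat_0_less_iff less_trans[OF zero_less_numeral p(2)])
  then consider "k = 1" | "k = 2" | "k = 3" | "k = 4" | "k = 5" | "k = 6" by linarith
  then show ?thesis
  proof cases
    case 1 then have "form False x y = int p" using k by (simp add: form_def)
    then show ?thesis by blast
  next
    case 2
    then have "even (x\<^sup>2 + 6 * y\<^sup>2)" using k by simp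
    then obtain z where "x = 2 * z" by (auto elim: evenE)
    then have "form True z y = int p" using k 2 by (simp add: form_def power2_eq_square)
    then show ?thesis by blast
  next
    case 3
    then have "x\<^sup>2 = 3 * (int p - 2 * y\<^sup>2)" using k by simp
    then have "3 dvd x\<^sup>2" by (rule dvdI)
    then have "3 dvd x" by (rule prime_dvd_power[rotated]) simp
    then obtain z where "x = 3 * z" by (elim dvdE)
    then have "form True y z = int p" using k 3 by (simp add: form_def power2_eq_square)
    then show ?thesis by blast
  next
    case 4
    then have "even (x\<^sup>2 + 6 * y\<^sup>2)" using k by simp
    then obtain z where z: "x = 2 * z" by (auto elim: evenE)
    then have "3 * y\<^sup>2 = 2 * (int p - z\<^sup>2)" using k 4 by (simp add: power2_eq_square)
    then have "even (3 * y\<^sup>2)" by (rule dvdI)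
    then obtain w where "y = 2 * w" by (auto elim: evenE)
    then have "form False z w = int p" using k 4 z by (simp add: form_def power2_eq_square)
    then show ?thesis by blast
  next
    case 5
    \<comment> \<open>As 5 = 2 + 3 is itself represented by the second form, the Hecke recurrence at
      5 turns a representation of 5 p into one of p by that form.\<close>
    have "(x, y) \<in> reps False (5 * p)" using k 5 by (simp add: reps_def form_def)
    then have "rep_count False (5 * p) > 0"
      unfolding rep_count_def using finite_reps card_gt_0_iff by blast
    moreover have "rep_count False (5 * p) + card {(x, y). int 5 * form False x y = int p} = 2 * rep_count True p"
      using rep_count_split[of 5 True 1 1 True p] by (simp add: form_def)
    ultimately have "rep_count True p > 0" by linarith
    then have "reps True p \<noteq> {}" unfolding rep_count_def using card_gt_0_iff by blast
    then show ?thesis by (auto simp: reps_def)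
  next
    case 6
    then have "x\<^sup>2 = 6 * (int p - y\<^sup>2)" using k by simp
    then have "6 dvd x\<^sup>2" by (rule dvdI)
    moreover have "2 dvd a \<and> 3 dvd a" if "6 dvd a" for a :: int using that by presburger
    ultimately have "2 dvd x\<^sup>2" "3 dvd x\<^sup>2" by blast+
    then have "2 dvd x" "3 dvd x" using prime_dvd_power[of 2 x 2] prime_dvd_power[of 3 x 2] by simp_all
    then have "6 dvd x" by presburger
    then obtain z where "x = 6 * z" by (elim dvdE)
    then have "form False y z = int p" using k 6 by (simp add: form_def power2_eq_square)
    then show ?thesis by blast
  qed
qed

lemma square_mod_24: "x\<^sup>2 mod 24 = (if even x then if 3 dvd x then if 4 dvd x then 0 else 12 else if 4 dvd x then 16 else 4 else if 3 dvd x then 9 else 1)"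
  for x :: int
proof -
  have "x\<^sup>2 mod 24 = (x mod 24)\<^sup>2 mod 24" by (simp add: power_mod)
  moreover have "even x \<longleftrightarrow> even (x mod 24)" "3 dvd x \<longleftrightarrow> 3 dvd x mod 24" "4 dvd x \<longleftrightarrow> 4 dvd x mod 24" by presburger+
  moreover have "x mod 24 \<in> {0..<24}" by simp
  then have "x mod 24 \<in> set [0..23]" by auto
  then have "x mod 24 \<in> {0, 1, 2, 3, 4, 5, 6, 7, 8, 9, 10, 11, 12, 13, 14, 15, 16, 17, 18, 19, 20, 21, 22, 23}"
    by (simp add: upto_rec1)
  ultimately show ?thesis by (elim insertE emptyE) simp_all
qed

text \<open>The two classes have different genera: on numbers prime to 6 their residues modulo 24
  are disjoint.\<close>

lemma form_mod_24:
  assumes "form b u v = int p" "odd p" "\<not> 3 dvd p"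
  shows "p mod 24 \<in> (if b then {5, 11} else {1, 7})"
proof -
  have p: "odd (int p)" "\<not> 3 dvd int p" using assms(2,3) by presburger+
  show ?thesis
  proof (cases b)
    case True
    then have uv: "2 * u\<^sup>2 + 3 * v\<^sup>2 = int p" using assms(1) by (simp add: form_def)
    have "odd v" using p(1) unfolding uv[symmetric] by simp
    moreover have "\<not> 3 dvd u"
    proof
      assume "3 dvd u"
      then have "3 dvd 2 * u\<^sup>2 + 3 * v\<^sup>2" by (simp add: power2_eq_square)
      then show False using p(2) uv by simp
    qed
    moreover have "int (p mod 24) = (2 * (u\<^sup>2 mod 24) + 3 * (v\<^sup>2 mod 24)) mod 24"
      unfolding zmod_int uv[symmetric] of_nat_numeral cong_def[symmetric]
      by (intro cong_add cong_mult) simp_all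
    ultimately show ?thesis
      using True unfolding square_mod_24 by (auto split: if_splits)
  next
    case False
    then have uv: "u\<^sup>2 + 6 * v\<^sup>2 = int p" using assms(1) by (simp add: form_def)
    have "odd u" using p(1) unfolding uv[symmetric] by simp
    moreover have "\<not> 3 dvd u"
    proof
      assume "3 dvd u"
      moreover have "3 dvd 6 * v\<^sup>2" by (rule dvd_mult2) simp
      ultimately have "3 dvd u\<^sup>2 + 6 * v\<^sup>2" by (simp add: power2_eq_square)
      then show False using p(2) uv by simp
    qed
    moreover have "int (p mod 24) = (u\<^sup>2 mod 24 + 6 * (v\<^sup>2 mod 24)) mod 24"
      unfolding zmod_int uv[symmetric] of_nat_numeral cong_def[symmetric]
      by (intro cong_add cong_mult) simp_all
    ultimately show ?thesis
      using False unfolding square_mod_24 by (auto split: if_splits)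
  qed
qed

text \<open>Gauss' lemma with multiplier 2: for x up to h = (p - 1) / 2 the product 2 x needs no
  reduction modulo p, and it exceeds h exactly when x > h div 2.\<close>

lemma Legendre_two:
  assumes p: "prime p" "p > 2"
  shows "Legendre 2 (int p) = (-1) ^ ((p - 1) div 2 - (p - 1) div 2 div 2)"
proof -
  have "\<not> int p dvd 2" using p(2) by (auto dest: zdvd_imp_le)
  then interpret G: GAUSS p 2
    using p by unfold_locales (simp_all add: cong_0_iff)
  define h where "h = (int p - 1) div 2"
  have C: "G.C = (\<lambda>x. x * 2) ` {0<..h}"
    unfolding G.C_def G.B_def G.A_def h_def[symmetric] image_image
    by (rule image_cong) (auto simp: h_def intro!: mod_pos_pos_trivial)
  have "G.E = (\<lambda>x. x * 2) ` {h div 2<..h}"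
    unfolding G.E_def C h_def[symmetric] using p by (auto simp: h_def)
  then have "card G.E = nat (h - h div 2)"
    by (simp add: card_image inj_on_def)
  also have "\<dots> = (p - 1) div 2 - (p - 1) div 2 div 2"
    using p(2) unfolding h_def by linarith
  finally show ?thesis using G.gauss_lemma by simp
qed

lemma Legendre_mod_3:
  assumes "\<not> 3 dvd p"
  shows "Legendre (int p) 3 = (if p mod 3 = 1 then 1 else -1)"
proof -
  have sq: "y\<^sup>2 mod 3 = 0 \<or> y\<^sup>2 mod 3 = 1" for y :: int
  proof -
    have "y\<^sup>2 mod 3 = (y mod 3)\<^sup>2 mod 3" by (simp add: power_mod)
    moreover have "y mod 3 = 0 \<or> y mod 3 = 1 \<or> y mod 3 = 2" by presburger
    ultimately show ?thesis by auto
  qed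
  have "p mod 3 = 1 \<or> p mod 3 = 2" using assms by presburger
  then have "int p mod 3 = 1 \<and> p mod 3 = 1 \<or> int p mod 3 = 2 \<and> p mod 3 = 2"
    by (metis zmod_int of_nat_1 of_nat_numeral)
  then show ?thesis
  proof
    assume "int p mod 3 = 1 \<and> p mod 3 = 1"
    then show ?thesis
      by (auto simp: Legendre_def QuadRes_def cong_def intro: exI[of _ 1])
  next
    assume *: "int p mod 3 = 2 \<and> p mod 3 = 2"
    then have "\<not> QuadRes 3 (int p)" unfolding QuadRes_def cong_def by (metis sq zero_neq_numeral one_eq_numeral_iff semiring_norm(85))
    then show ?thesis using * by (simp add: Legendre_def cong_def)
  qed
qed

lemma odd_not_3_dvd_if_mod_24:
  "p mod 24 \<in> {1, 5, 7, 11} \<union> {13, 17, 19, 23} \<Longrightarrow> odd p \<and> \<not> 3 dvd p" for p :: nat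
  unfolding Un_iff insert_iff empty_iff by presburger

lemma form_scale: "form d (k * x) (k * y) = k * (k * form d x y)"
  by (simp add: form_def power2_eq_square algebra_simps)

text \<open>The symbol of -6 is the product of those of -1, 2 and 3. Writing p = 24 k + r makes the
  parity of every exponent explicit, and the product is 1 in all four cases.\<close>

lemma minus_six_residue:
  assumes p: "prime p" "p mod 24 \<in> {1, 5, 7, 11}" "p > 3"
  shows "\<exists>t. int p dvd t\<^sup>2 + 6"
proof -
  define h where "h = (p - 1) div 2"
  have "\<not> 3 dvd p" using odd_not_3_dvd_if_mod_24 p(2) by blast
  then have "p \<noteq> 3" by auto
  have E: "[Legendre a (int p) = a ^ h] (mod int p)" for a
    unfolding h_def using euler_criterion[of p a] p by simp
  have "Legendre 3 (int p) * Legendre (int p) 3 = (-1) ^ h"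
    using Quadratic_Reciprocity[of 3 p] p \<open>p \<noteq> 3\<close> by (simp add: h_def)
  then have L3: "Legendre 3 (int p) = (-1) ^ h * (if p mod 3 = 1 then 1 else -1)"
    unfolding Legendre_mod_3[OF \<open>\<not> 3 dvd p\<close>] by (auto split: if_splits)
  have L2: "Legendre 2 (int p) = (-1) ^ (h - h div 2)"
    unfolding h_def using p by (intro Legendre_two) auto
  define k where "k = p div 24"
  have "p = 24 * k + 1 \<or> p = 24 * k + 5 \<or> p = 24 * k + 7 \<or> p = 24 * k + 11"
    using p(2) mult_div_mod_eq[of 24 p, folded k_def] unfolding insert_iff empty_iff by metis
  then have one: "(-1) ^ h * (Legendre 2 (int p) * Legendre 3 (int p)) = 1"
  proof (elim disjE)
    assume pk: "p = 24 * k + 1"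
    then have "h = 2 * (6 * k)" "h - h div 2 = 2 * (3 * k)" "p mod 3 = 1" unfolding h_def by presburger+
    then show ?thesis unfolding L2 L3 by simp
  next
    assume pk: "p = 24 * k + 5"
    then have "h = 2 * (6 * k + 1)" "h - h div 2 = 2 * (3 * k) + 1" "p mod 3 = 2" unfolding h_def by presburger+
    then show ?thesis unfolding L2 L3 by simp
  next
    assume pk: "p = 24 * k + 7"
    then have "h = 2 * (6 * k + 1) + 1" "h - h div 2 = 2 * (3 * k + 1)" "p mod 3 = 1" unfolding h_def by presburger+
    then show ?thesis unfolding L2 L3 by simp
  next
    assume pk: "p = 24 * k + 11"
    then have "h = 2 * (6 * k + 2) + 1" "h - h div 2 = 2 * (3 * k + 1) + 1" "p mod 3 = 2" unfolding h_def by presburger+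
    then show ?thesis unfolding L2 L3 by simp
  qed
  have "[(-1) ^ h * (Legendre 2 (int p) * Legendre 3 (int p)) = (-1) ^ h * (2 ^ h * 3 ^ h)] (mod int p)"
    by (intro cong_mult cong_refl E)
  also have "(-1) ^ h * (2 ^ h * 3 ^ h) = (-6 :: int) ^ h"
    by (simp flip: power_mult_distrib)
  finally have "[Legendre (-6) (int p) = 1] (mod int p)"
    unfolding one using E[of "-6"] by (meson cong_sym cong_trans)
  then have "int p dvd Legendre (-6) (int p) - 1" by (simp add: cong_iff_dvd_diff)
  \<comment> \<open>The values 0 and -1 of the Legendre symbol are not congruent to 1 modulo p, so
    the congruence determines the symbol.\<close>
  moreover have "\<not> int p dvd 0 - 1" "\<not> int p dvd - 1 - 1" using p(3) by (auto dest: zdvd_imp_le)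
  ultimately have "QuadRes (int p) (-6)" unfolding Legendre_def by (auto split: if_splits)
  then show ?thesis by (auto simp: QuadRes_def cong_iff_dvd_diff)
qed

text \<open>If p did not divide y, then -6 would be a square modulo p, so one of the forms would
  represent p, against its residue modulo 24.\<close>

lemma inert_dvd:
  assumes p: "prime p" "p mod 24 \<in> {13, 17, 19, 23}" and dvd: "int p dvd form b x y"
  shows "int p dvd x \<and> int p dvd y"
proof -
  have p3: "odd p" "\<not> 3 dvd p" using odd_not_3_dvd_if_mod_24 p(2) by blast+
  moreover have "p \<noteq> 1" using p(1) by auto
  ultimately have p_gt: "p > 3" by presburger
  have prime: "prime (int p)" using p(1) by simp
  have n2: "\<not> int p dvd 2" using p_gt by (auto dest: zdvd_imp_le)
  \<comment> \<open>Doubling the second form gives (2 x)^2 + 6 y^2, so both classes are treated as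
    the principal form.\<close>
  define X where "X = (if b then 2 * x else x)"
  have "X\<^sup>2 + 6 * y\<^sup>2 = (if b then 2 else 1) * form b x y"
    by (simp add: X_def form_def power2_eq_square)
  then have X: "int p dvd X\<^sup>2 + 6 * y\<^sup>2" using dvd by simp
  have y: "int p dvd y"
  proof (rule ccontr)
    assume "\<not> int p dvd y"
    then have "coprime y (int p)" using prime prime_imp_coprime coprime_commute by blast
    then obtain z where "[y * z = 1] (mod int p)" using cong_solve_coprime_int by blast
    then have z: "int p dvd 1 - y * z" by (metis cong_iff_dvd_diff cong_sym)
    have "(X * z)\<^sup>2 + 6 = (X\<^sup>2 + 6 * y\<^sup>2) * z\<^sup>2 + (1 - y * z) * (6 * (1 + y * z))"
      by (simp add: power2_eq_square algebra_simps)
    then have "int p dvd (X * z)\<^sup>2 + 6" using X z by simp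
    then obtain b u v where "form b u v = int p" using prime_form_exists[OF p(1) p_gt] by blast
    from form_mod_24[OF this p3] show False using p(2) by (auto split: if_splits)
  qed
  then have "int p dvd 6 * y\<^sup>2" by (simp add: power2_eq_square)
  then have "int p dvd X\<^sup>2" using X by (simp add: dvd_add_left_iff)
  then have "int p dvd X" using prime by (simp add: prime_dvd_power)
  then have "int p dvd x" using n2 prime_dvd_mult_iff[OF prime] by (auto simp: X_def split: if_splits)
  with y show ?thesis by simp
qed

text \<open>Every representation of a multiple of p is divisible by p, so its value is divisible by
  p^2; dividing the coordinates by p lowers the exponent by 2.\<close>

lemma rep_count_inert_power:
  assumes p: "prime p" "p mod 24 \<in> {13, 17, 19, 23}" and m: "\<not> p dvd m"
  shows "rep_count d (p ^ k * m) = (if even k then rep_count d m else 0)"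
proof (induction k rule: induct_nat_012)
  case 0 show ?case by simp
next
  case 1
  have p0: "p > 0" using p(1) prime_gt_0_nat by blast
  have "form d x y \<noteq> int (p * m)" for x y
  proof
    assume *: "form d x y = int (p * m)"
    then have "int p dvd form d x y" by simp
    then obtain r s where "x = int p * r" "y = int p * s"
      using inert_dvd[OF p] by (metis dvdE)
    then have "int p * (int p * form d r s) = int p * int m"
      using * by (simp add: form_scale)
    then have "int m = int p * form d r s" using p0 by simp
    then have "int p dvd int m" by simp
    then show False using m by simp
  qed
  then show ?case by (simp add: rep_count_def reps_def)
next
  case (ge2 k)
  have p0: "p > 0" using p(1) prime_gt_0_nat by blast
  have "rep_count d (p ^ Suc (Suc k) * m) = rep_count d (p ^ k * m)"
  proof (rule rep_count_eqI[where m = "\<lambda>(x, y). (int p * x, int p * y)"])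
    have scale: "form d (int p * r) (int p * s) = int (p ^ Suc (Suc k) * m) \<longleftrightarrow> form d r s = int (p ^ k * m)" for r s
    proof -
      have "form d (int p * r) (int p * s) = int p * int p * form d r s"
        by (simp add: form_scale)
      moreover have "int (p ^ Suc (Suc k) * m) = int p * int p * int (p ^ k * m)" by simp
      ultimately show ?thesis using p0 by (simp only: mult_cancel_left) simp
    qed
    show "form d x y = int (p ^ Suc (Suc k) * m) \<longleftrightarrow>
        (\<exists>r s. (x, y) = (case (r, s) of (x, y) \<Rightarrow> (int p * x, int p * y)) \<and> form d r s = int (p ^ k * m))" for x y
    proof
      assume *: "form d x y = int (p ^ Suc (Suc k) * m)"
      then have "int p dvd form d x y" by simp
      then obtain r s where "x = int p * r" "y = int p * s"
        using inert_dvd[OF p] by (metis dvdE)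
      then show "\<exists>r s. (x, y) = (case (r, s) of (x, y) \<Rightarrow> (int p * x, int p * y)) \<and> form d r s = int (p ^ k * m)"
        using * scale by auto
    qed (use scale in auto)
  qed (use p0 in \<open>auto simp: inj_def\<close>)
  then show ?case using ge2.IH by simp
qed

lemma split_form:
  assumes p: "prime p" "p mod 24 \<in> {1, 5, 7, 11}"
  obtains u v where "form (p mod 24 \<in> {5, 11}) u v = int p" "p > 3"
proof -
  have "p \<noteq> 1" using p(1) by auto
  have p3: "odd p" "\<not> 3 dvd p" using odd_not_3_dvd_if_mod_24 p(2) by blast+
  with \<open>p \<noteq> 1\<close> have p_gt: "p > 3" by presburger
  obtain b u v where uv: "form b u v = int p"
    using minus_six_residue[OF p p_gt] prime_form_exists[OF p(1) p_gt] by blast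
  from form_mod_24[OF this p3] have "b = (p mod 24 \<in> {5, 11})" by (auto split: if_splits)
  with uv p_gt that show ?thesis by blast
qed

section \<open>The product formula for the number of representations\<close>

lemma coprime_prod_power_not_dvd:
  fixes p :: "'i \<Rightarrow> nat"
  assumes "finite I" "prime r" "\<And>i. i \<in> I \<Longrightarrow> prime (p i) \<and> p i \<noteq> r" "\<not> r dvd M"
  shows "\<not> r dvd (\<Prod>i\<in>I. p i ^ v i) * M"
proof
  assume "r dvd (\<Prod>i\<in>I. p i ^ v i) * M"
  then have "r dvd (\<Prod>i\<in>I. p i ^ v i)" using assms(2,4) by (simp add: prime_dvd_mult_iff)
  then obtain i where "i \<in> I" "r dvd p i ^ v i" using assms(1,2) by (auto simp: prime_dvd_prod_iff)
  then have "r dvd p i" using assms(2) by (simp add: prime_dvd_power)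
  then show False using assms(2,3) \<open>i \<in> I\<close> primes_dvd_imp_eq by blast
qed

text \<open>Primes are removed one at a time, each being prime to what remains. A prime congruent to
  5 or 11 lies in the non-principal class, so its exponent shifts the class by its parity.\<close>

lemma rep_count_prod_split:
  fixes p v :: "'i \<Rightarrow> nat"
  assumes "finite I" "inj_on p I" "\<And>i. i \<in> I \<Longrightarrow> prime (p i) \<and> p i mod 24 \<in> {1, 5, 7, 11}"
    and "\<And>i. i \<in> I \<Longrightarrow> \<not> p i dvd M"
  shows "rep_count d ((\<Prod>i\<in>I. p i ^ v i) * M) =
    (\<Prod>i\<in>I. 1 + v i) * rep_count (d \<noteq> odd (\<Sum>i\<in>I. if p i mod 24 \<in> {5, 11} then v i else 0)) M"
  using assms
proof (induction I arbitrary: d rule: finite_induct)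
  case (insert j I)
  define N where "N = (\<Prod>i\<in>I. p i ^ v i) * M"
  have j: "prime (p j)" "p j mod 24 \<in> {1, 5, 7, 11}" using insert.prems by auto
  have "\<not> p j dvd N"
    unfolding N_def using insert.prems insert.hyps j
    by (intro coprime_prod_power_not_dvd) (auto simp: inj_on_def)
  moreover obtain x y where "form (p j mod 24 \<in> {5, 11}) x y = int (p j)" "p j > 3"
    using split_form[OF j] by blast
  ultimately have "rep_count d (p j ^ v j * N) = (1 + v j) * rep_count (d \<noteq> (p j mod 24 \<in> {5, 11} \<and> odd (v j))) N"
    using rep_count_split_power[OF j(1), of "p j mod 24 \<in> {5, 11}" x y N d "v j"] by simp
  also have "rep_count (d \<noteq> (p j mod 24 \<in> {5, 11} \<and> odd (v j))) N = (\<Prod>i\<in>I. 1 + v i) *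
      rep_count ((d \<noteq> (p j mod 24 \<in> {5, 11} \<and> odd (v j))) \<noteq> odd (\<Sum>i\<in>I. if p i mod 24 \<in> {5, 11} then v i else 0)) M"
    unfolding N_def using insert.prems by (intro insert.IH) (auto simp: inj_on_def)
  also have "((d \<noteq> (p j mod 24 \<in> {5, 11} \<and> odd (v j))) \<noteq> odd (\<Sum>i\<in>I. if p i mod 24 \<in> {5, 11} then v i else 0)) =
      (d \<noteq> odd (\<Sum>i\<in>insert j I. if p i mod 24 \<in> {5, 11} then v i else 0))"
    using insert.hyps by auto
  also have "p j ^ v j * N = (\<Prod>i\<in>insert j I. p i ^ v i) * M"
    using insert.hyps by (simp add: N_def mult.assoc)
  finally show ?case
    unfolding prod.insert[OF insert.hyps, of "\<lambda>i. 1 + v i"] mult.assoc .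
qed simp

lemma rep_count_prod_inert:
  fixes q w :: "'i \<Rightarrow> nat"
  assumes "finite I" "inj_on q I" "\<And>i. i \<in> I \<Longrightarrow> prime (q i) \<and> q i mod 24 \<in> {13, 17, 19, 23}"
    and "\<And>i. i \<in> I \<Longrightarrow> \<not> q i dvd M"
  shows "int (rep_count d ((\<Prod>i\<in>I. q i ^ w i) * M)) = (\<Prod>i\<in>I. (1 + (-1) ^ w i) div 2) * int (rep_count d M)"
  using assms
proof (induction I rule: finite_induct)
  case (insert j I)
  define N where "N = (\<Prod>i\<in>I. q i ^ w i) * M"
  have j: "prime (q j)" "q j mod 24 \<in> {13, 17, 19, 23}" using insert.prems by auto
  have "\<not> q j dvd N"
    unfolding N_def using insert.prems insert.hyps j
    by (intro coprime_prod_power_not_dvd) (auto simp: inj_on_def)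
  then have "int (rep_count d (q j ^ w j * N)) = (1 + (-1) ^ w j) div 2 * int (rep_count d N)"
    using rep_count_inert_power[OF j, of N d "w j"] by simp
  also have "int (rep_count d N) = (\<Prod>i\<in>I. (1 + (-1) ^ w i) div 2) * int (rep_count d M)"
    unfolding N_def using insert.prems by (intro insert.IH) (auto simp: inj_on_def)
  finally show ?case
    using insert.hyps by (simp add: N_def mult.assoc)
qed simp

lemma rep_count_two_three_power: "rep_count d (2 ^ a * 3 ^ b * M) = rep_count (d \<noteq> odd (a + b)) M"
proof (induction a arbitrary: d)
  case 0
  show ?case
  proof (induction b arbitrary: d)
    case (Suc b) then show ?case using rep_count_triple[of d "3 ^ b * M"]
      by (cases d; cases "even b") (simp_all add: mult.assoc)
  qed simp
next
  case (Suc a)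
  then show ?case using rep_count_double[of d "2 ^ a * 3 ^ b * M"]
    by (cases d; cases "even (a + b)") (simp_all add: mult.assoc)
qed

lemma size_filter_prime_factorization_mult:
  fixes m n :: nat
  assumes "m \<noteq> 0" "n \<noteq> 0"
  shows "size {#l \<in># prime_factorization (m * n). P l#} =
    size {#l \<in># prime_factorization m. P l#} + size {#l \<in># prime_factorization n. P l#}"
  using assms by (simp add: prime_factorization_mult)

lemma size_filter_prime_factorization_power:
  fixes p :: nat
  assumes "prime p"
  shows "size {#l \<in># prime_factorization (p ^ v). P l#} = (if P p then v else 0)"
proof (induction v)
  case (Suc v)
  then show ?case
    using assms size_filter_prime_factorization_mult[of p "p ^ v" P]
    by (auto simp: prime_factorization_prime)
qed simp

lemma size_filter_prime_factorization_prod: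
  fixes p v :: "'i \<Rightarrow> nat"
  assumes "finite I" "\<And>i. i \<in> I \<Longrightarrow> prime (p i)"
  shows "size {#l \<in># prime_factorization (\<Prod>i\<in>I. p i ^ v i). P l#} = (\<Sum>i\<in>I. if P (p i) then v i else 0)"
  using assms
proof (induction I rule: finite_induct)
  case (insert j I)
  have "(\<Prod>i\<in>I. p i ^ v i) \<noteq> 0" "p j ^ v j \<noteq> 0"
    using insert by (auto simp: prime_gt_0_nat intro!: prod_pos)
  then show ?case
    using insert by (simp add: size_filter_prime_factorization_mult size_filter_prime_factorization_power)
qed simp

text \<open>Removing all prime powers reduces the count to the representations of 1 by the class
  given by the parity of a + b + t.\<close>

lemma num_reps_formula:
  fixes n a b r s t :: nat and p v q w :: "nat \<Rightarrow> nat"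
  assumes n: "n = 2 ^ a * 3 ^ b * (\<Prod>i=1..r. p i ^ v i) * (\<Prod>j=1..s. q j ^ w j)"
    and p: "inj_on p {1..r}" "\<forall>i\<in>{1..r}. prime (p i) \<and> p i mod 24 \<in> {1, 5, 7, 11}"
    and q: "inj_on q {1..s}" "\<forall>j\<in>{1..s}. prime (q j) \<and> q j mod 24 \<in> {13, 17, 19, 23}"
    and t: "t = size {#l \<in># prime_factorization n. l mod 24 \<in> {5, 11}#}"
  shows "int (num_reps n (\<lambda>x y. x\<^sup>2 + 6 * y\<^sup>2)) =
    (1 + (-1) ^ (a + b + t)) * (\<Prod>i=1..r. 1 + int (v i)) * (\<Prod>j=1..s. (1 + (-1) ^ w j) div 2)"
proof -
  define A B where "A = (\<Prod>i=1..r. p i ^ v i)" and "B = (\<Prod>j=1..s. q j ^ w j)"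
  have pos: "A \<noteq> 0" "B \<noteq> 0"
    unfolding A_def B_def using p(2) q(2) by (auto simp: prod_pos prime_gt_0_nat)
  \<comment> \<open>The primes 2, 3 and all \<open>q j\<close> have residues other than 5 and 11, so
    only the \<open>p i\<close> contribute to t.\<close>
  have "t = (\<Sum>i=1..r. if p i mod 24 \<in> {5, 11} then v i else 0) + (\<Sum>j=1..s. if q j mod 24 \<in> {5, 11} then w j else 0)"
  proof -
    have "size {#l \<in># prime_factorization (2 ^ a :: nat). l mod 24 \<in> {5, 11}#} = 0"
      "size {#l \<in># prime_factorization (3 ^ b :: nat). l mod 24 \<in> {5, 11}#} = 0"
      by (subst size_filter_prime_factorization_power; simp)+
    then have "t = size {#l \<in># prime_factorization A. l mod 24 \<in> {5, 11}#} + size {#l \<in># prime_factorization B. l mod 24 \<in> {5, 11}#}"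
      unfolding t n A_def[symmetric] B_def[symmetric]
      using pos by (simp add: size_filter_prime_factorization_mult)
    also have "size {#l \<in># prime_factorization A. l mod 24 \<in> {5, 11}#} = (\<Sum>i=1..r. if p i mod 24 \<in> {5, 11} then v i else 0)"
      unfolding A_def by (rule size_filter_prime_factorization_prod) (use p(2) in auto)
    also have "size {#l \<in># prime_factorization B. l mod 24 \<in> {5, 11}#} = (\<Sum>j=1..s. if q j mod 24 \<in> {5, 11} then w j else 0)"
      unfolding B_def by (rule size_filter_prime_factorization_prod) (use q(2) in auto)
    finally show ?thesis .
  qed
  also have "(\<Sum>j=1..s. if q j mod 24 \<in> {5, 11} then w j else 0) = 0"
    using q(2) by (intro sum.neutral) auto
  finally have t': "t = (\<Sum>i=1..r. if p i mod 24 \<in> {5, 11} then v i else 0)" by simp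
  have ndvd: "\<not> p i dvd B" if "i \<in> {1..r}" for i
    using coprime_prod_power_not_dvd[of "{1..s}" "p i" q 1 w] p(2) q(2) that
    unfolding B_def by (fastforce simp: prime_nat_iff)
  have "num_reps n (\<lambda>x y. x\<^sup>2 + 6 * y\<^sup>2) = rep_count False (2 ^ a * 3 ^ b * (A * B))"
    unfolding num_reps_def rep_count_def reps_def form_def n A_def B_def by (simp add: mult_ac)
  also have "\<dots> = rep_count (odd (a + b)) (A * B)"
    unfolding rep_count_two_three_power by simp
  also have "\<dots> = (\<Prod>i=1..r. 1 + v i) * rep_count (odd (a + b) \<noteq> odd t) B"
    unfolding t' A_def using p ndvd by (intro rep_count_prod_split) auto
  also have "(odd (a + b) \<noteq> odd t) = odd (a + b + t)"
    unfolding even_add[of "a + b" t] by blast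
  finally have "int (num_reps n (\<lambda>x y. x\<^sup>2 + 6 * y\<^sup>2)) = (\<Prod>i=1..r. 1 + int (v i)) * int (rep_count (odd (a + b + t)) B)"
    by (simp add: of_nat_prod)
  also have "int (rep_count (odd (a + b + t)) B) = (\<Prod>j=1..s. (1 + (-1) ^ w j) div 2) * int (rep_count (odd (a + b + t)) 1)"
    using rep_count_prod_inert[of "{1..s}" q 1 "odd (a + b + t)" w] q
    unfolding B_def by (fastforce simp: prime_nat_iff)
  \<comment> \<open>The number 1 has the two representations (1, 0) and (-1, 0) by x^2 + 6 y^2 and
    none by 2 x^2 + 3 y^2; this is the origin of the factor 0 or 2.\<close>
  also have "int (rep_count (odd (a + b + t)) 1) = 1 + (-1) ^ (a + b + t)"
    unfolding rep_count_one by simp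
  finally show ?thesis by (simp only: mult_ac)
qed

theorem theorem1p1:
  shows "(\<forall>n::nat.
            [int (overp_odd (3 * n)) = f_sign n * int (num_reps n (\<lambda>x y. x\<^sup>2 + 6 * y\<^sup>2))] (mod 3) \<and>
            [int (ped (3 * n + 1)) =
               (-1) ^ (n + 1) * int (num_reps (8 * n + 3) (\<lambda>x y. 2 * x\<^sup>2 + 3 * y\<^sup>2))] (mod 3))
       \<and> (\<forall>(n::nat) (a::nat) (b::nat) (r::nat) (s::nat) (t::nat)
            (p :: nat \<Rightarrow> nat) (v :: nat \<Rightarrow> nat) (q :: nat \<Rightarrow> nat) (w :: nat \<Rightarrow> nat).
            n \<ge> 1 \<longrightarrow>
            n = 2 ^ a * 3 ^ b * (\<Prod>i=1..r. p i ^ v i) * (\<Prod>j=1..s. q j ^ w j) \<longrightarrow>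
            inj_on p {1..r} \<longrightarrow>
            (\<forall>i\<in>{1..r}. prime (p i) \<and> p i mod 24 \<in> {1, 5, 7, 11}) \<longrightarrow>
            inj_on q {1..s} \<longrightarrow>
            (\<forall>j\<in>{1..s}. prime (q j) \<and> q j mod 24 \<in> {13, 17, 19, 23}) \<longrightarrow>
            t = size {#l \<in># prime_factorization n. l mod 24 \<in> {5, 11}#} \<longrightarrow>
            [int (overp_odd (3 * n)) =
               f_sign n * (1 + (-1) ^ (a + b + t)) * (\<Prod>i=1..r. 1 + int (v i))
                 * (\<Prod>j=1..s. (1 + (-1) ^ w j) div 2)] (mod 3))
       \<and> (\<forall>n::nat. [(-1) ^ n * int (ped (3 * n + 1)) = int (overp_odd (48 * n + 18))] (mod 3))"
proof (intro conjI allI impI)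
  fix n
  show "[int (overp_odd (3 * n)) = f_sign n * int (num_reps n (\<lambda>x y. x\<^sup>2 + 6 * y\<^sup>2))] (mod 3)"
    by (rule overp_odd_cong)
  show "[int (ped (3 * n + 1)) = (-1) ^ (n + 1) * int (num_reps (8 * n + 3) (\<lambda>x y. 2 * x\<^sup>2 + 3 * y\<^sup>2))] (mod 3)"
    by (rule ped_cong)
  show "[(-1) ^ n * int (ped (3 * n + 1)) = int (overp_odd (48 * n + 18))] (mod 3)"
    by (rule ped_overp_odd_cong)
next
  fix n a b r s t :: nat and p v q w :: "nat \<Rightarrow> nat"
  assume "n = 2 ^ a * 3 ^ b * (\<Prod>i=1..r. p i ^ v i) * (\<Prod>j=1..s. q j ^ w j)"
    and "inj_on p {1..r}" "\<forall>i\<in>{1..r}. prime (p i) \<and> p i mod 24 \<in> {1, 5, 7, 11}"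
    and "inj_on q {1..s}" "\<forall>j\<in>{1..s}. prime (q j) \<and> q j mod 24 \<in> {13, 17, 19, 23}"
    and "t = size {#l \<in># prime_factorization n. l mod 24 \<in> {5, 11}#}"
  from num_reps_formula[OF this] overp_odd_cong[of n]
  show "[int (overp_odd (3 * n)) = f_sign n * (1 + (-1) ^ (a + b + t)) * (\<Prod>i=1..r. 1 + int (v i)) *
      (\<Prod>j=1..s. (1 + (-1) ^ w j) div 2)] (mod 3)"
    by (simp only: mult.assoc)
qed

end
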